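(* Consider an inhomogeneous spiked Wigner matrix model with arbitrary variance profiles $\Delta^{(N)}$ (possibly having infinite entries), with entrywise reciprocals $\Phi^{(N)}$, such that the limit $\widehat\mu_1:=\lim_{N\to\infty}\lambda_1(\Phi^{(N)})/N$ exists and is strictly positive; set $\beta_*:=1/\sqrt{\widehat\mu_1}$. Let $\nu$ be a probability measure on $\mathbb{R}$ (not depending on $N$), let $\mathcal{P}_N$ be the law of $x\in\mathbb{R}^N$ with i.i.d. entries drawn from $\nu$, and let the signal law $\mathcal{X}_N$ be the law of $X=\frac{\beta}{\sqrt N}xx^\top$ with $x\sim\mathcal{P}_N$, for some constant $\beta>0$. Suppose that (a) $\mathbb{E}_{x\sim\nu}[x]=0$; (b) $\mathbb{E}_{x\sim\nu}[x^2]=1$; (c) $\nu$ has bounded support. Suppose also that (d) $\lim_{N\to\infty}\max_{i\in[N]}\|v_i(\Phi^{(N)})\|_\infty=0$, where $v_1(\Phi^{(N)}),\dots,v_N(\Phi^{(N)})$ are the unit eigenvectors of $\Phi^{(N)}$ (an orthonormal eigenbasis associated to the ordered eigenvalues); (e) either $\Phi^{(N)}\succeq0$ for all $N\ge1$, or there is $K$ not depending on $N$ such that $\mathrm{rank}(\Phi^{(N)})\le K$ for all $N\ge1$ and the limits $\widehat\mu_i:=\lim_{N\to\infty}\lambda_i(\Phi^{(N)})/N$ exist for each $i=1,\dots,K$. If $\beta>\beta_*$ and $D=D(N)\in\mathbb{N}$ satisfies $D(N)\to\infty$ as $N\to\infty$, then $\chi^2_{\le D(N)}(\mathbb{P}_N\mid\mathbb{Q}_N)\to\infty$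 as $N\to\infty$.
   Context: Inhomogeneous spiked Wigner matrix model: for each $N\ge1$, let $\mathcal{X}_N$ be a probability measure on real symmetric $N\times N$ matrices and $\Delta=\Delta^{(N)}\in(\mathbb{R}_{>0}\cup\{+\infty\})^{N\times N}$ symmetric (the variance profile). Let $\mathcal J=\mathcal J^{(N)}=\{(i,j):1\le i\le j\le N,\ \Delta_{ij}\ne+\infty\}$. Two probability measures on $\mathbb{R}^{\mathcal J}$ are defined: under $\mathbb{Q}_N$, $Y_{ij}\sim\mathcal N(0,\Delta_{ij})$ independently for $(i,j)\in\mathcal J$; under $\mathbb{P}_N$, first draw $X\sim\mathcal{X}_N$, then draw $Y_{ij}\sim\mathcal N(X_{ij},\Delta_{ij})$ independently for $(i,j)\in\mathcal J$. $\Phi^{(N)}_{ij}=1/\Delta^{(N)}_{ij}$ with the convention $1/(+\infty)=0$. $\lambda_1\ge\cdots\ge\lambda_N$ are the ordered eigenvalues of a symmetric matrix. Low-degree $\chi^2$-divergence: with $\mathbb{R}[Y]_{\le D}$ the polynomials of degree at most $D$ in the variables $Y_{ij}$, $(i,j)\in\mathcal J$, $$\chi^2_{\le D}(\mathbb{P}\mid\mathbb{Q}):=\sup_{f\in\mathbb{R}[Y]_{\le D}\setminus\{0\}}\frac{(\mathbb{E}_{\mathbb{P}}[f(Y)])^2}{\mathbb{E}_{\mathbb{Q}}[f(Y)^2]}-1.$$ *)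

theory Defs
  imports
    "HOL-Probability.Probability"
    "HOL-Library.Poly_Mapping"
    "Jordan_Normal_Form.DL_Rank"
    "Jordan_Normal_Form.Char_Poly"
begin

text \<open>
  Matrices and vectors are those of \<^theory>\<open>Jordan_Normal_Form.Matrix\<close>: their coordinates run over
  \<open>{..<N}\<close>.  Eigenvalues and eigenvectors are numbered from 1, the largest eigenvalue coming first.
\<close>

subsection \<open>Symmetric matrices\<close>

definition symmetric_matrix :: "nat \<Rightarrow> 'a Matrix.mat \<Rightarrow> bool" where
  "symmetric_matrix N A \<longleftrightarrow> A \<in> carrier_mat N N \<and> transpose_mat A = A"

text \<open>
  The \<open>i\<close>-th largest real eigenvalue, counted with algebraic multiplicity.  A real symmetric
  \<open>N \<times> N\<close> matrix has exactly \<open>N\<close> of them; \<open>eigval A i\<close> is unspecified outside \<open>1 \<le> i \<le> N\<close>.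
\<close>
definition eigval :: "real Matrix.mat \<Rightarrow> nat \<Rightarrow> real" where
  "eigval A i = rev (sorted_list_of_multiset (proots (char_poly A))) ! (i - 1)"

definition ordered_eigenbasis :: "nat \<Rightarrow> real Matrix.mat \<Rightarrow> (nat \<Rightarrow> real Matrix.vec) \<Rightarrow> bool" where
  "ordered_eigenbasis N A v \<longleftrightarrow>
     (\<forall>i\<in>{1..N}. v i \<in> carrier_vec N \<and> eigenvector A (v i) (eigval A i)) \<and>
     (\<forall>i\<in>{1..N}. \<forall>j\<in>{1..N}. scalar_prod (v i) (v j) = (if i = j then 1 else 0))"

definition psd :: "nat \<Rightarrow> real Matrix.mat \<Rightarrow> bool" where
  "psd N A \<longleftrightarrow> symmetric_matrix N A \<and>
     (\<forall>x\<in>carrier_vec N. 0 \<le> scalar_prod x (mult_mat_vec A x))"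

definition sup_norm :: "real Matrix.vec \<Rightarrow> real" where
  "sup_norm v = Max ((\<lambda>j. \<bar>vec_index v j\<bar>) ` {..<dim_vec v})"

subsection \<open>Polynomials in several variables\<close>

text \<open>
  A polynomial maps exponent vectors to coefficients, both with finite support.  This keeps
  ``nonzero polynomial'' separate from ``nonzero polynomial function''.
\<close>
type_synonym 'v mpoly = "('v \<Rightarrow>\<^sub>0 nat) \<Rightarrow>\<^sub>0 real"

definition mpoly_eval :: "'v mpoly \<Rightarrow> ('v \<Rightarrow> real) \<Rightarrow> real" where
  "mpoly_eval f y =
     (\<Sum>m\<in>Poly_Mapping.keys f. Poly_Mapping.lookup f m *
        (\<Prod>a\<in>Poly_Mapping.keys m. y a ^ Poly_Mapping.lookup m a))"

definition mpolys_le :: "'v set \<Rightarrow> nat \<Rightarrow> 'v mpoly set" where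
  "mpolys_le J D = {f. \<forall>m\<in>Poly_Mapping.keys f. Poly_Mapping.keys m \<subseteq> J \<and>
                       (\<Sum>a\<in>Poly_Mapping.keys m. Poly_Mapping.lookup m a) \<le> D}"

text \<open>
  Extended-real valued, since for an arbitrary \<open>P\<close> the supremum need not be finite.  The definition
  is meant for laws on \<open>\<real>\<^sup>J\<close> all of whose moments exist, as a Bochner integral that
  does not exist has the value 0.
\<close>
definition low_degree_chi2 ::
  "'v set \<Rightarrow> nat \<Rightarrow> ('v \<Rightarrow> real) measure \<Rightarrow> ('v \<Rightarrow> real) measure \<Rightarrow> ereal" where
  "low_degree_chi2 J D P Q =
     (SUP f\<in>mpolys_le J D - {0}.
        ereal ((\<integral>y. mpoly_eval f y \<partial>P)\<^sup>2 / (\<integral>y. (mpoly_eval f y)\<^sup>2 \<partial>Q))) - 1"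

subsection \<open>The inhomogeneous spiked Wigner matrix model\<close>

definition variance_profile :: "nat \<Rightarrow> ereal Matrix.mat \<Rightarrow> bool" where
  "variance_profile N \<Delta> \<longleftrightarrow>
     symmetric_matrix N \<Delta> \<and> (\<forall>i<N. \<forall>j<N. 0 < \<Delta> $$ (i, j))"

text \<open>Note that \<open>1 / \<infinity> = 0\<close> in \<^typ>\<open>ereal\<close>.\<close>
definition recip_profile :: "ereal Matrix.mat \<Rightarrow> real Matrix.mat" where
  "recip_profile \<Delta> = map_mat (\<lambda>d. real_of_ereal (1 / d)) \<Delta>"

definition observed :: "ereal Matrix.mat \<Rightarrow> (nat \<times> nat) set" where
  "observed \<Delta> = {(i, j). i \<le> j \<and> j < dim_row \<Delta> \<and> \<Delta> $$ (i, j) \<noteq> \<infinity>}"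

definition normal_law :: "real \<Rightarrow> real \<Rightarrow> real measure" where
  "normal_law m \<sigma>2 = density lborel (\<lambda>y. ennreal (normal_density m (sqrt \<sigma>2) y))"

text \<open>The law of the observations given the signal matrix \<open>X\<close>.\<close>
definition obs_law ::
  "ereal Matrix.mat \<Rightarrow> (nat \<times> nat \<Rightarrow> real) \<Rightarrow> (nat \<times> nat \<Rightarrow> real) measure" where
  "obs_law \<Delta> X =
     (\<Pi>\<^sub>M e\<in>observed \<Delta>. normal_law (X e) (real_of_ereal (\<Delta> $$ e)))"

definition null_law :: "ereal Matrix.mat \<Rightarrow> (nat \<times> nat \<Rightarrow> real) measure" where
  "null_law \<Delta> = obs_law \<Delta> (\<lambda>_. 0)"

text \<open>
  The signal law is a measure on matrices viewed as families indexed by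
  \<open>{..<N} \<times> {..<N}\<close>, because the type of matrices carries no sigma-algebra.
\<close>
definition planted_law ::
  "ereal Matrix.mat \<Rightarrow> (nat \<times> nat \<Rightarrow> real) measure \<Rightarrow> (nat \<times> nat \<Rightarrow> real) measure" where
  "planted_law \<Delta> \<X> = \<X> \<bind> obs_law \<Delta>"

definition iid_law :: "nat \<Rightarrow> real measure \<Rightarrow> (nat \<Rightarrow> real) measure" where
  "iid_law N \<nu> = (\<Pi>\<^sub>M i\<in>{..<N}. \<nu>)"

definition spike_signal :: "nat \<Rightarrow> real \<Rightarrow> (nat \<Rightarrow> real) measure \<Rightarrow> (nat \<times> nat \<Rightarrow> real) measure" where
  "spike_signal N \<beta> \<P> =
     distr \<P> (\<Pi>\<^sub>M e\<in>{..<N} \<times> {..<N}. borel)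
       (\<lambda>x. \<lambda>(i, j)\<in>{..<N} \<times> {..<N}. \<beta> / sqrt (real N) * (x i * x j))"

definition measure_support :: "'a::topological_space measure \<Rightarrow> 'a set" where
  "measure_support M = {x. \<forall>U. open U \<and> x \<in> U \<longrightarrow> 0 < emeasure M U}"

end

theory Submission
  imports Defs "HOL-Real_Asymp.Real_Asymp"
begin

text \<open>
  A single test polynomial suffices: the signed count of \<open>d\<close>-cycles
  \<open>f(Y) = \<Sum> \<Prod>\<^sub>e \<Phi>\<^sub>e Y\<^sub>e\<close>, summed over the closed walks of length \<open>d\<close> with distinct vertices, for a
  fixed even \<open>d\<close>.  Distinct cycles are orthogonal under the null law and each one has signal
  \<open>(\<beta> / \<surd>N)\<^sup>d\<close>, so the ratio is at least \<open>(\<beta>\<^sup>2 / N)\<^sup>d S / d\<^sup>2\<close>, where \<open>S\<close> is the total \<open>\<Phi>\<close>-weight of the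
  walks.  The weight of all closed walks is \<open>tr \<Phi>\<^sup>d \<ge> \<lambda>\<^sub>1\<^sup>d\<close>.  A closed walk that repeats a vertex \<open>x\<close>
  splits at \<open>x\<close>, hence such walks contribute at most \<open>d\<^sup>2\<close> terms
  \<open>\<Sum>\<^sub>x (\<Phi>\<^sup>p)\<^sub>x\<^sub>x (\<Phi>\<^sup>d\<^sup>-\<^sup>p)\<^sub>x\<^sub>x \<le> \<delta>\<^sup>2 (\<Sum>\<^sub>k \<bar>\<lambda>\<^sub>k\<bar>)\<^sup>d\<close>, where \<open>\<delta>\<close> bounds the entries of the eigenvectors.
  If \<open>\<Sum>\<^sub>k \<bar>\<lambda>\<^sub>k\<bar> = O(N)\<close> this is negligible after division by \<open>N\<^sup>d\<close>, and since \<open>\<beta>\<^sup>2 \<mu>\<^sub>1 > 1\<close> the ratio exceeds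
  any bound once \<open>d\<close> is large.  In the bounded rank case \<open>\<Sum>\<^sub>k \<bar>\<lambda>\<^sub>k\<bar> \<le> 2 K \<lambda>\<^sub>1\<close>.  In the positive semidefinite
  case \<open>\<Sum>\<^sub>k \<bar>\<lambda>\<^sub>k\<bar> = tr \<Phi>\<close>, and when this is not \<open>O(N)\<close> the linear polynomial \<open>\<Sum>\<^sub>i \<Phi>\<^sub>i\<^sub>i Y\<^sub>i\<^sub>i\<close>, whose ratio
  is \<open>\<beta>\<^sup>2 tr \<Phi> / N\<close>, is a good test instead.
\<close>

subsection \<open>Multilinear test polynomials\<close>

lemma mpoly_eval_superset:
  assumes "finite K" "Poly_Mapping.keys f \<subseteq> K"
  shows "mpoly_eval f y =
    (\<Sum>m\<in>K. Poly_Mapping.lookup f m * (\<Prod>a\<in>Poly_Mapping.keys m. y a ^ Poly_Mapping.lookup m a))"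
  unfolding mpoly_eval_def using assms
  by (intro sum.mono_neutral_left) (auto simp: in_keys_iff)

lemma mpoly_eval_single:
  "mpoly_eval (Poly_Mapping.single m c) y =
    c * (\<Prod>a\<in>Poly_Mapping.keys m. y a ^ Poly_Mapping.lookup m a)"
  by (subst mpoly_eval_superset[of "{m}"]) (auto split: if_splits)

lemma mpoly_eval_add: "mpoly_eval (f + g) y = mpoly_eval f y + mpoly_eval g y"
proof -
  let ?K = "Poly_Mapping.keys f \<union> Poly_Mapping.keys g"
  have "Poly_Mapping.keys (f + g) \<subseteq> ?K"
    by (rule keys_add)
  then show ?thesis
    by (subst (1 2 3) mpoly_eval_superset[of ?K])
       (auto simp: lookup_add algebra_simps sum.distrib)
qed

lemma mpoly_eval_sum: "mpoly_eval (sum f I) y = (\<Sum>i\<in>I. mpoly_eval (f i) y)"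
  by (induction I rule: infinite_finite_induct)
     (auto simp: mpoly_eval_add, auto simp: mpoly_eval_def)

definition squarefree_monom :: "'v set \<Rightarrow> ('v \<Rightarrow>\<^sub>0 nat)" where
  "squarefree_monom E = (\<Sum>a\<in>E. Poly_Mapping.single a 1)"

lemma lookup_squarefree_monom:
  "finite E \<Longrightarrow> Poly_Mapping.lookup (squarefree_monom E) a = (if a \<in> E then 1 else 0)"
  by (simp add: squarefree_monom_def lookup_sum lookup_single when_def)

lemma keys_squarefree_monom: "finite E \<Longrightarrow> Poly_Mapping.keys (squarefree_monom E) = E"
  by (auto simp: in_keys_iff lookup_squarefree_monom split: if_splits)

text \<open>Monomials are indexed by \<open>I\<close> and not by their sets of variables, since
  several walks trace the same cycle; their coefficients then add up.\<close>

definition multilinear_poly :: "'i set \<Rightarrow> ('i \<Rightarrow> 'v set) \<Rightarrow> ('i \<Rightarrow> real) \<Rightarrow> 'v mpoly" where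
  "multilinear_poly I E c = (\<Sum>i\<in>I. Poly_Mapping.single (squarefree_monom (E i)) (c i))"

lemma mpoly_eval_multilinear_poly:
  assumes "\<And>i. i \<in> I \<Longrightarrow> finite (E i)"
  shows "mpoly_eval (multilinear_poly I E c) y = (\<Sum>i\<in>I. c i * (\<Prod>e\<in>E i. y e))"
  unfolding multilinear_poly_def mpoly_eval_sum mpoly_eval_single
  using assms by (intro sum.cong) (auto simp: keys_squarefree_monom lookup_squarefree_monom)

lemma multilinear_poly_in_mpolys_le:
  assumes "\<And>i. i \<in> I \<Longrightarrow> finite (E i) \<and> E i \<subseteq> J \<and> card (E i) \<le> D"
  shows "multilinear_poly I E c \<in> mpolys_le J D"
proof -
  have "\<exists>i\<in>I. m = squarefree_monom (E i)"
    if "m \<in> Poly_Mapping.keys (multilinear_poly I E c)" for m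
  proof (rule ccontr)
    assume "\<not> ?thesis"
    then have "Poly_Mapping.lookup (multilinear_poly I E c) m = 0"
      by (auto simp: multilinear_poly_def lookup_sum lookup_single when_def intro!: sum.neutral)
    with that show False by (simp add: in_keys_iff)
  qed
  with assms show ?thesis
    unfolding mpolys_le_def
    by (fastforce simp: keys_squarefree_monom lookup_squarefree_monom)
qed

lemma low_degree_chi2_ge:
  assumes "f \<in> mpolys_le J D" "f \<noteq> 0"
  shows "ereal ((\<integral>y. mpoly_eval f y \<partial>P)\<^sup>2 / (\<integral>y. (mpoly_eval f y)\<^sup>2 \<partial>Q) - 1)
    \<le> low_degree_chi2 J D P Q"
proof -
  have "ereal ((\<integral>y. mpoly_eval f y \<partial>P)\<^sup>2 / (\<integral>y. (mpoly_eval f y)\<^sup>2 \<partial>Q)) - 1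
    \<le> low_degree_chi2 J D P Q"
    unfolding low_degree_chi2_def using assms
    by (intro ereal_minus_mono SUP_upper) auto
  then show ?thesis by (simp add: one_ereal_def)
qed

subsection \<open>The null and planted laws\<close>

lemma
  assumes "s > 0"
  shows prob_space_normal_law: "prob_space (normal_law m s)"
    and integrable_normal_law: "integrable (normal_law 0 s) (\<lambda>y. y)"
      "integrable (normal_law 0 s) (\<lambda>y. y\<^sup>2)"
    and integral_normal_law: "(\<integral>y. y \<partial>normal_law 0 s) = 0"
      "(\<integral>y. y\<^sup>2 \<partial>normal_law 0 s) = s"
proof -
  have s: "sqrt s > 0" using assms by simp
  show "prob_space (normal_law m s)"
    unfolding normal_law_def by (rule prob_space_normal_density[OF s])
  have "has_bochner_integral (normal_law 0 s) (\<lambda>y. y) 0"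
    unfolding normal_law_def
    using normal_moment_odd[OF s, of 0 0] by (intro has_bochner_integral_density) auto
  moreover have "has_bochner_integral (normal_law 0 s) (\<lambda>y. y\<^sup>2) s"
    unfolding normal_law_def
    using normal_moment_even[OF s, of 0 1] assms
    by (intro has_bochner_integral_density) (auto simp: numeral_2_eq_2[symmetric])
  ultimately show "integrable (normal_law 0 s) (\<lambda>y. y)" "integrable (normal_law 0 s) (\<lambda>y. y\<^sup>2)"
    "(\<integral>y. y \<partial>normal_law 0 s) = 0" "(\<integral>y. y\<^sup>2 \<partial>normal_law 0 s) = s"
    by (auto simp: has_bochner_integral_iff)
qed

lemma sets_normal_law [measurable_cong, simp]: "sets (normal_law m s) = sets borel"
  by (simp add: normal_law_def)

lemma normal_law_shift:
  assumes "s > 0"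
  shows "normal_law m s = distr (normal_law 0 s) borel (\<lambda>y. m + y)"
proof -
  interpret prob_space "normal_law 0 s" using assms by (rule prob_space_normal_law)
  have "distributed (normal_law 0 s) lborel (\<lambda>x. x) (normal_density 0 (sqrt s))"
    unfolding distributed_def by (auto simp: normal_law_def distr_id2 intro!: measure_eqI) 
  from normal_density_affine[OF this, of 1 m] assms
  have "distributed (normal_law 0 s) lborel (\<lambda>x. m + x) (normal_density m (sqrt s))"
    by simp
  from distributed_distr_eq_density[OF this] show ?thesis
    unfolding normal_law_def by (metis (no_types, lifting) distr_cong sets_lborel)
qed

lemma
  assumes "variance_profile N \<Delta>"
  shows finite_observed: "finite (observed \<Delta>)"
    and observed_subset: "observed \<Delta> \<subseteq> {..<N} \<times> {..<N}"
    and observed_pos: "e \<in> observed \<Delta> \<Longrightarrow> real_of_ereal (\<Delta> $$ e) > 0"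
proof -
  have dim: "dim_row \<Delta> = N" using assms by (auto simp: variance_profile_def symmetric_matrix_def)
  show *: "observed \<Delta> \<subseteq> {..<N} \<times> {..<N}" by (auto simp: observed_def dim)
  show "finite (observed \<Delta>)" using * by (rule finite_subset) auto
  show "real_of_ereal (\<Delta> $$ e) > 0" if "e \<in> observed \<Delta>"
  proof -
    obtain i j where e: "e = (i, j)" by (cases e)
    have "0 < \<Delta> $$ e" "\<Delta> $$ e \<noteq> \<infinity>"
      using that * assms by (auto simp: observed_def variance_profile_def e dim)
    then show ?thesis by (simp add: zero_less_real_of_ereal)
  qed
qed

text \<open>The value 1 off the observed entries keeps every factor a probability measure, as
  \<open>product_prob_space\<close> asks for all indices.\<close>

definition obs_variance :: "ereal Matrix.mat \<Rightarrow> nat \<times> nat \<Rightarrow> real" where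
  "obs_variance \<Delta> e = (if e \<in> observed \<Delta> then real_of_ereal (\<Delta> $$ e) else 1)"

lemma obs_law_eq_PiM:
  "obs_law \<Delta> X = (\<Pi>\<^sub>M e\<in>observed \<Delta>. normal_law (X e) (obs_variance \<Delta> e))"
  unfolding obs_law_def by (intro PiM_cong) (auto simp: obs_variance_def)

lemma sets_obs_law [measurable_cong, simp]:
  "sets (obs_law \<Delta> X) = sets (\<Pi>\<^sub>M e\<in>observed \<Delta>. borel)"
  unfolding obs_law_def by (intro sets_PiM_cong) auto

lemma sets_null_law [measurable_cong, simp]:
  "sets (null_law \<Delta>) = sets (\<Pi>\<^sub>M e\<in>observed \<Delta>. borel)"
  by (simp add: null_law_def)

lemma product_prob_space_normal_law:
  assumes "variance_profile N \<Delta>"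
  shows "product_prob_space (\<lambda>e. normal_law (X e) (obs_variance \<Delta> e))"
  using observed_pos[OF assms]
  by (intro product_prob_spaceI prob_space_normal_law) (auto simp: obs_variance_def)

lemma prob_space_obs_law:
  assumes "variance_profile N \<Delta>"
  shows "prob_space (obs_law \<Delta> X)"
  using observed_pos[OF assms] unfolding obs_law_eq_PiM
  by (intro prob_space_PiM prob_space_normal_law) (auto simp: obs_variance_def)

text \<open>Each coordinate is a translated centred Gaussian, and product measures are compared on
  boxes. In this form the dependence on \<open>X\<close> sits in the map and no longer in the
  measure.\<close>

lemma obs_law_shift:
  assumes "variance_profile N \<Delta>"
  shows "obs_law \<Delta> X = distr (null_law \<Delta>) (\<Pi>\<^sub>M e\<in>observed \<Delta>. borel) (\<lambda>y. \<lambda>e\<in>observed \<Delta>. X e + y e)"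
    (is "_ = ?P")
proof -
  let ?J = "observed \<Delta>"
  let ?L = "\<lambda>X e. normal_law (X e) (obs_variance \<Delta> e)"
  interpret X: product_prob_space "?L X" by (rule product_prob_space_normal_law[OF assms])
  interpret O: product_prob_space "?L (\<lambda>_. 0)" 
    by (rule product_prob_space_normal_law[OF assms, of "\<lambda>_. 0"])
  have J: "finite ?J" by (rule finite_observed[OF assms])
  have pos: "obs_variance \<Delta> e > 0" for e
    using observed_pos[OF assms] by (auto simp: obs_variance_def)
  have "?P = PiM ?J (?L X)"
  proof (rule X.PiM_eqI[OF J])
    show "sets ?P = sets (PiM ?J (?L X))" by (simp cong: sets_PiM_cong)
  next
    fix A assume "\<And>e. e \<in> ?J \<Longrightarrow> A e \<in> sets (?L X e)"
    then have A: "A e \<in> sets borel" if "e \<in> ?J" for e using that by simp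
    have shift: "(\<lambda>t. X e + t) -` A e \<in> sets borel" if "e \<in> ?J" for e
      using measurable_sets[of "\<lambda>t. X e + t" borel borel "A e"] A[OF that] by simp
    have "emeasure ?P (Pi\<^sub>E ?J A) =
        emeasure (null_law \<Delta>) ((\<lambda>y. \<lambda>e\<in>?J. X e + y e) -` Pi\<^sub>E ?J A \<inter> space (null_law \<Delta>))"
      using A J by (intro emeasure_distr sets_PiM_I_finite) auto
    also have "(\<lambda>y. \<lambda>e\<in>?J. X e + y e) -` Pi\<^sub>E ?J A \<inter> space (null_law \<Delta>) =
        (\<Pi>\<^sub>E e\<in>?J. (\<lambda>t. X e + t) -` A e)"
      by (auto simp: null_law_def obs_law_def space_PiM PiE_iff normal_law_def)
    also have "emeasure (null_law \<Delta>) \<dots> = (\<Prod>e\<in>?J. emeasure (?L (\<lambda>_. 0) e) ((\<lambda>t. X e + t) -` A e))"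
      unfolding null_law_def obs_law_eq_PiM using J shift by (intro O.emeasure_PiM) auto
    also have "\<dots> = (\<Prod>e\<in>?J. emeasure (?L X e) (A e))"
    proof (rule prod.cong[OF refl])
      fix e assume e: "e \<in> ?J"
      show "emeasure (?L (\<lambda>_. 0) e) ((\<lambda>t. X e + t) -` A e) = emeasure (?L X e) (A e)"
        using A[OF e] by (subst (2) normal_law_shift[OF pos])
          (simp add: emeasure_distr, simp add: normal_law_def)
    qed
    finally show "emeasure ?P (Pi\<^sub>E ?J A) = (\<Prod>e\<in>?J. emeasure (?L X e) (A e))" .
  qed
  then show ?thesis by (simp add: obs_law_eq_PiM)
qed

text \<open>By independence the integral factors over the entries. An entry in both sets contributes
  its variance, an entry in neither contributes 1, and an entry in exactly one contributes the mean
  0. Hence distinct square-free monomials are orthogonal.\<close>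

lemma
  assumes "variance_profile N \<Delta>" "E \<subseteq> observed \<Delta>" "E' \<subseteq> observed \<Delta>"
  shows integrable_null_law_prod_prod:
      "integrable (null_law \<Delta>) (\<lambda>y. (\<Prod>e\<in>E. y e) * (\<Prod>e\<in>E'. y e))"
    and integral_null_law_prod_prod:
      "(\<integral>y. (\<Prod>e\<in>E. y e) * (\<Prod>e\<in>E'. y e) \<partial>null_law \<Delta>) =
         (if E = E' then \<Prod>e\<in>E. real_of_ereal (\<Delta> $$ e) else 0)"
proof -
  let ?J = "observed \<Delta>" and ?L = "\<lambda>e. normal_law 0 (obs_variance \<Delta> e)"
  interpret O: product_prob_space ?L
    by (rule product_prob_space_normal_law[OF assms(1), of "\<lambda>_. 0"])
  have J: "finite ?J" by (rule finite_observed[OF assms(1)])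
  have null: "null_law \<Delta> = PiM ?J ?L" by (simp add: null_law_def obs_law_eq_PiM)
  have pos: "obs_variance \<Delta> e > 0" for e
    using observed_pos[OF assms(1)] by (auto simp: obs_variance_def)
  define g :: "nat \<times> nat \<Rightarrow> real \<Rightarrow> real"
    where "g e t = (if e \<in> E then t else 1) * (if e \<in> E' then t else 1)" for e t
  have g_cases: "g e = (if e \<in> E \<and> e \<in> E' then (\<lambda>t. t\<^sup>2) else if e \<in> E \<or> e \<in> E' then (\<lambda>t. t) else (\<lambda>t. 1))" for e
    by (auto simp: g_def power2_eq_square fun_eq_iff)
  have prod_g: "(\<Prod>e\<in>E. y e) * (\<Prod>e\<in>E'. y e) = (\<Prod>e\<in>?J. g e (y e))" for y
    unfolding g_def prod.distrib using assms J
    by (simp add: prod.inter_restrict[symmetric] Int_absorb1)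
  have int: "integrable (?L e) (g e)" for e
    using integrable_normal_law[OF pos[of e]] 
      prob_space.finite_measure[OF prob_space_normal_law[OF pos[of e], of 0]]
    by (auto simp: g_cases finite_measure.integrable_const)
  show "integrable (null_law \<Delta>) (\<lambda>y. (\<Prod>e\<in>E. y e) * (\<Prod>e\<in>E'. y e))"
    unfolding prod_g null by (rule O.product_integrable_prod[OF J int])
  have "(\<integral>y. (\<Prod>e\<in>E. y e) * (\<Prod>e\<in>E'. y e) \<partial>null_law \<Delta>) = (\<Prod>e\<in>?J. integral\<^sup>L (?L e) (g e))"
    unfolding prod_g null by (rule O.product_integral_prod[OF J int])
  also have "\<dots> = (if E = E' then \<Prod>e\<in>E. real_of_ereal (\<Delta> $$ e) else 0)"
  proof (cases "E = E'")
    case True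
    have "(\<Prod>e\<in>?J. integral\<^sup>L (?L e) (g e)) = (\<Prod>e\<in>?J. if e \<in> E then real_of_ereal (\<Delta> $$ e) else 1)"
      using integral_normal_law(2)[OF pos] prob_space.prob_space[OF prob_space_normal_law[OF pos]] True
      by (intro prod.cong) (auto simp: g_cases, auto simp: obs_variance_def)
    also have "\<dots> = (\<Prod>e\<in>E. real_of_ereal (\<Delta> $$ e))"
      using assms J by (simp add: prod.inter_restrict[symmetric] Int_absorb1)
    finally show ?thesis using True by simp
  next
    case False
    then obtain e where e: "e \<in> E \<union> E'" "\<not> (e \<in> E \<and> e \<in> E')" by blast
    then have "integral\<^sup>L (?L e) (g e) = 0"
      using integral_normal_law(1)[OF pos] by (auto simp: g_cases)
    moreover have "e \<in> ?J" using e assms by auto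
    ultimately have "(\<Prod>e\<in>?J. integral\<^sup>L (?L e) (g e)) = 0"
      using J by (intro prod_zero) auto
    then show ?thesis using False by simp
  qed
  finally show "(\<integral>y. (\<Prod>e\<in>E. y e) * (\<Prod>e\<in>E'. y e) \<partial>null_law \<Delta>) =
         (if E = E' then \<Prod>e\<in>E. real_of_ereal (\<Delta> $$ e) else 0)" .
qed

section \<open>The planted law as signal plus independent noise\<close>

lemma (in pair_prob_space) has_bochner_integral_pair_mult:
  fixes u :: "'a \<Rightarrow> real" and w :: "'b \<Rightarrow> real"
  assumes u: "integrable M1 u" and w: "integrable M2 w"
  shows "has_bochner_integral (M1 \<Otimes>\<^sub>M M2) (\<lambda>z. u (fst z) * w (snd z))
    (integral\<^sup>L M1 u * integral\<^sup>L M2 w)"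
proof -
  note [measurable] = borel_measurable_integrable[OF u] borel_measurable_integrable[OF w]
  have int: "integrable (M1 \<Otimes>\<^sub>M M2) (\<lambda>z. u (fst z) * w (snd z))"
    using u w by (intro Fubini_integrable) (auto simp: abs_mult)
  from integral_fst'[OF this] show ?thesis
    using int u w by (simp add: has_bochner_integral_iff)
qed

lemma measurable_add_spike:
  assumes "variance_profile N \<Delta>" "sets \<nu> = sets borel"
  shows "(\<lambda>z. \<lambda>e\<in>observed \<Delta>. c * (fst z (fst e) * fst z (snd e)) + snd z e :: real)
    \<in> iid_law N \<nu> \<Otimes>\<^sub>M null_law \<Delta> \<rightarrow>\<^sub>M (\<Pi>\<^sub>M e\<in>observed \<Delta>. borel)"
proof (intro measurable_restrict)
  have [measurable_cong]: "sets (iid_law N \<nu>) = sets (\<Pi>\<^sub>M i\<in>{..<N}. borel)"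
    unfolding iid_law_def by (intro sets_PiM_cong) (auto simp: assms)
  fix e assume e: "e \<in> observed \<Delta>"
  then have "fst e \<in> {..<N}" "snd e \<in> {..<N}" using observed_subset[OF assms(1)] by auto
  with e show "(\<lambda>z. c * (fst z (fst e) * fst z (snd e)) + snd z e)
      \<in> borel_measurable (iid_law N \<nu> \<Otimes>\<^sub>M null_law \<Delta>)"
    by measurable
qed

text \<open>An observation is the signal plus independent null noise, so the mixture is the image of
  a product measure under addition.\<close>

lemma planted_law_spike_eq_distr:
  assumes "variance_profile N \<Delta>" "prob_space \<nu>" and [measurable_cong]: "sets \<nu> = sets borel"
  shows "planted_law \<Delta> (spike_signal N \<beta> (iid_law N \<nu>)) =
    distr (iid_law N \<nu> \<Otimes>\<^sub>M null_law \<Delta>) (\<Pi>\<^sub>M e\<in>observed \<Delta>. borel)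
      (\<lambda>z. \<lambda>e\<in>observed \<Delta>. \<beta> / sqrt (real N) * (fst z (fst e) * fst z (snd e)) + snd z e)"
  (is "_ = distr (?I \<Otimes>\<^sub>M ?Q) ?B ?F")
proof -
  let ?J = "observed \<Delta>" and ?N2 = "{..<N} \<times> {..<N}"
  interpret Q: prob_space ?Q using prob_space_obs_law[OF assms(1)] by (simp add: null_law_def)
  interpret I: prob_space ?I unfolding iid_law_def by (intro prob_space_PiM assms)
  have J: "finite ?J" "?J \<subseteq> ?N2" using finite_observed observed_subset assms(1) by auto
  have [measurable_cong]: "sets ?I = sets (\<Pi>\<^sub>M i\<in>{..<N}. borel)"
    unfolding iid_law_def by (intro sets_PiM_cong) (auto simp: assms)
  define h where "h = (\<lambda>x. \<lambda>(i, j)\<in>?N2. \<beta> / sqrt (real N) * (x i * x j :: real))"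
  have h_alt: "h = (\<lambda>x. \<lambda>e\<in>?N2. \<beta> / sqrt (real N) * (x (fst e) * x (snd e)))"
    by (auto simp: h_def fun_eq_iff)
  have h [measurable]: "h \<in> ?I \<rightarrow>\<^sub>M (\<Pi>\<^sub>M e\<in>?N2. borel)"
    unfolding h_alt by (intro measurable_restrict) auto
  \<comment> \<open>The kernel is the image of the fixed law \<open>null_law \<Delta>\<close> under
    a map jointly measurable in signal and noise, which gives its measurability.\<close>
  have ker [measurable]: "obs_law \<Delta> \<in> (\<Pi>\<^sub>M e\<in>?N2. borel) \<rightarrow>\<^sub>M subprob_algebra ?B"
    unfolding obs_law_shift[OF assms(1), abs_def]
  proof (rule measurable_distr2)
    have [measurable]: "(\<lambda>z. fst z e + snd z e :: real) \<in> borel_measurable ((\<Pi>\<^sub>M e\<in>?N2. borel) \<Otimes>\<^sub>M ?B)"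
      if "e \<in> ?J" for e
    proof -
      have "e \<in> ?N2" using that J by auto
      then show ?thesis using that by measurable
    qed
    show "(\<lambda>(X, y). \<lambda>e\<in>?J. X e + y e :: real) \<in> (\<Pi>\<^sub>M e\<in>?N2. borel) \<Otimes>\<^sub>M ?B \<rightarrow>\<^sub>M ?B"
      unfolding split_beta by (intro measurable_restrict) auto
    show "(\<lambda>x. ?Q) \<in> (\<Pi>\<^sub>M e\<in>?N2. borel) \<rightarrow>\<^sub>M subprob_algebra ?B"
      using Q.M_in_subprob by (intro measurable_const) (simp add: subprob_algebra_cong[of ?Q ?B, symmetric])
  qed
  have F [measurable]: "?F \<in> ?I \<Otimes>\<^sub>M ?Q \<rightarrow>\<^sub>M ?B"
    by (rule measurable_add_spike[OF assms(1,3)])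
  have eq: "planted_law \<Delta> (spike_signal N \<beta> ?I) = ?I \<bind> (\<lambda>x. obs_law \<Delta> (h x))"
    unfolding planted_law_def spike_signal_def h_def[symmetric]
    by (rule bind_distr[OF h ker I.not_empty])
  have hker: "(\<lambda>x. obs_law \<Delta> (h x)) \<in> ?I \<rightarrow>\<^sub>M subprob_algebra ?B" by measurable
  show ?thesis
    unfolding eq
  proof (rule measure_eqI)
    have "sets (?I \<bind> (\<lambda>x. obs_law \<Delta> (h x))) = sets ?B"
      using hker I.not_empty by (intro sets_bind) (auto dest: measurable_space simp: sets_kernel)
    then show "sets (?I \<bind> (\<lambda>x. obs_law \<Delta> (h x))) = sets (distr (?I \<Otimes>\<^sub>M ?Q) ?B ?F)" by simp
    fix A assume "A \<in> sets (?I \<bind> (\<lambda>x. obs_law \<Delta> (h x)))"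
    then have A [measurable]: "A \<in> sets ?B"
      using \<open>sets (?I \<bind> (\<lambda>x. obs_law \<Delta> (h x))) = sets ?B\<close> by simp
    have "emeasure (?I \<bind> (\<lambda>x. obs_law \<Delta> (h x))) A = (\<integral>\<^sup>+x. emeasure (obs_law \<Delta> (h x)) A \<partial>?I)"
      by (rule emeasure_bind[OF I.not_empty hker A])
    also have "\<dots> = (\<integral>\<^sup>+x. emeasure ?Q (Pair x -` (?F -` A \<inter> space (?I \<Otimes>\<^sub>M ?Q))) \<partial>?I)"
    proof (rule nn_integral_cong)
      fix x assume x: "x \<in> space ?I"
      have *: "(\<lambda>y. \<lambda>e\<in>?J. h x e + y e) \<in> ?Q \<rightarrow>\<^sub>M ?B"
        by (intro measurable_restrict) auto
      have "(\<lambda>y. \<lambda>e\<in>?J. h x e + y e) -` A \<inter> space ?Q = Pair x -` (?F -` A \<inter> space (?I \<Otimes>\<^sub>M ?Q))"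
        using x J by (auto simp: space_pair_measure h_alt restrict_def subset_eq cong: if_cong)
      then show "emeasure (obs_law \<Delta> (h x)) A =
          emeasure ?Q (Pair x -` (?F -` A \<inter> space (?I \<Otimes>\<^sub>M ?Q)))"
        unfolding obs_law_shift[OF assms(1), of "h x"] by (simp add: emeasure_distr[OF * A])
    qed
    also have "\<dots> = emeasure (distr (?I \<Otimes>\<^sub>M ?Q) ?B ?F) A"
      by (subst emeasure_distr[OF F A]) (rule Q.emeasure_pair_measure_alt[symmetric], measurable)
    finally show "emeasure (?I \<bind> (\<lambda>x. obs_law \<Delta> (h x))) A = emeasure (distr (?I \<Otimes>\<^sub>M ?Q) ?B ?F) A" .
  qed
qed

text \<open>The product of signal plus noise over \<open>E\<close> expands over subsets
  \<open>T\<close>, the entries where the signal is chosen. The noise on \<open>E - T\<close> is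
  independent with mean zero, so only \<open>T = E\<close> survives. Each term is integrated on its
  own, which is why \<open>int\<close> speaks of every subset.\<close>

lemma has_bochner_integral_planted_prod:
  assumes "variance_profile N \<Delta>" "prob_space \<nu>" and sets: "sets \<nu> = sets borel"
    and E: "E \<subseteq> observed \<Delta>"
    and int: "\<And>T. T \<subseteq> E \<Longrightarrow> integrable (iid_law N \<nu>) (\<lambda>x. \<Prod>e\<in>T. x (fst e) * x (snd e))"
  shows "has_bochner_integral (planted_law \<Delta> (spike_signal N \<beta> (iid_law N \<nu>))) (\<lambda>y. \<Prod>e\<in>E. y e)
    ((\<beta> / sqrt (real N)) ^ card E * (\<integral>x. (\<Prod>e\<in>E. x (fst e) * x (snd e)) \<partial>iid_law N \<nu>))"
proof -
  let ?J = "observed \<Delta>" and ?c = "\<beta> / sqrt (real N)" and ?I = "iid_law N \<nu>" and ?Q = "null_law \<Delta>"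
  let ?B = "\<Pi>\<^sub>M e\<in>?J. borel :: real measure"
  interpret Q: prob_space ?Q using prob_space_obs_law[OF assms(1)] by (simp add: null_law_def)
  interpret I: prob_space ?I unfolding iid_law_def by (intro prob_space_PiM assms)
  interpret P: pair_prob_space ?I ?Q ..
  have J: "finite ?J" "?J \<subseteq> {..<N} \<times> {..<N}" using finite_observed observed_subset assms(1) by auto
  have E': "finite E" using E J finite_subset by blast
  let ?F = "\<lambda>z. \<lambda>e\<in>?J. ?c * (fst z (fst e) * fst z (snd e)) + snd z e"
  have F: "?F \<in> ?I \<Otimes>\<^sub>M ?Q \<rightarrow>\<^sub>M ?B"
    by (rule measurable_add_spike[OF assms(1) sets])
  have expand: "(\<Prod>e\<in>E. ?F z e) =
      (\<Sum>T\<in>Pow E. (?c ^ card T * (\<Prod>e\<in>T. fst z (fst e) * fst z (snd e))) * (\<Prod>e\<in>E - T. snd z e))" for z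
  proof -
    have "(\<Prod>e\<in>E. ?F z e) = (\<Prod>e\<in>E. ?c * (fst z (fst e) * fst z (snd e)) + snd z e)"
      using E by (intro prod.cong) auto
    then show ?thesis
      by (simp only: prod_add[OF E'] prod.distrib[of "\<lambda>_. ?c"] prod_constant)
  qed
  have summand: "has_bochner_integral (?I \<Otimes>\<^sub>M ?Q)
      (\<lambda>z. (?c ^ card T * (\<Prod>e\<in>T. fst z (fst e) * fst z (snd e))) * (\<Prod>e\<in>E - T. snd z e))
      ((?c ^ card T * (\<integral>x. (\<Prod>e\<in>T. x (fst e) * x (snd e)) \<partial>?I)) * (if E - T = {} then 1 else 0))"
    if "T \<in> Pow E" for T
  proof -
    have null: "integrable ?Q (\<lambda>y. \<Prod>e\<in>U. y e) \<and> (\<integral>y. (\<Prod>e\<in>U. y e) \<partial>?Q) = (if U = {} then 1 else 0)"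
      if "U \<subseteq> ?J" for U
      using integrable_null_law_prod_prod[OF assms(1) that, of "{}"]
        integral_null_law_prod_prod[OF assms(1) that, of "{}"] by (auto simp: Q.prob_space)
    have "E - T \<subseteq> ?J" using E by auto
    note null[OF this]
    moreover have "integrable ?I (\<lambda>x. ?c ^ card T * (\<Prod>e\<in>T. x (fst e) * x (snd e)))"
      using int that by simp
    ultimately show ?thesis
      using P.has_bochner_integral_pair_mult[of "\<lambda>x. ?c ^ card T * (\<Prod>e\<in>T. x (fst e) * x (snd e))"
        "\<lambda>y. \<Prod>e\<in>E - T. y e"] by simp
  qed
  have "has_bochner_integral (?I \<Otimes>\<^sub>M ?Q) (\<lambda>z. \<Prod>e\<in>E. ?F z e)
    (\<Sum>T\<in>Pow E. (?c ^ card T * (\<integral>x. (\<Prod>e\<in>T. x (fst e) * x (snd e)) \<partial>?I)) * (if E - T = {} then 1 else 0))"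
    unfolding expand by (rule has_bochner_integral_sum[OF summand])
  also have "(\<Sum>T\<in>Pow E. (?c ^ card T * (\<integral>x. (\<Prod>e\<in>T. x (fst e) * x (snd e)) \<partial>?I)) * (if E - T = {} then 1 else 0))
     = (\<Sum>T\<in>{E}. (?c ^ card T * (\<integral>x. (\<Prod>e\<in>T. x (fst e) * x (snd e)) \<partial>?I)))"
    using E' by (intro sum.mono_neutral_cong_right) auto
  finally have "has_bochner_integral (?I \<Otimes>\<^sub>M ?Q) (\<lambda>z. \<Prod>e\<in>E. ?F z e)
    (?c ^ card E * (\<integral>x. (\<Prod>e\<in>E. x (fst e) * x (snd e)) \<partial>?I))" by simp
  moreover have "(\<lambda>y. \<Prod>e\<in>E. y e) \<in> borel_measurable ?B"
    using E by (intro borel_measurable_prod measurable_component_singleton) auto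
  ultimately show ?thesis
    unfolding planted_law_spike_eq_distr[OF assms(1-3)]
    by (intro has_bochner_integral_distr[OF _ F])
qed

section \<open>Lower bounds from families of edge sets\<close>

lemma low_degree_chi2_ge_minus_one: "- 1 \<le> low_degree_chi2 J D P Q"
proof -
  \<comment> \<open>A nonzero constant lies in every degree class, and its ratio is nonnegative
    whatever the two measures are.\<close>
  let ?f = "Poly_Mapping.single 0 1 :: 'a mpoly"
  have "?f \<in> mpolys_le J D" by (simp add: mpolys_le_def)
  moreover have "?f \<noteq> 0" by (metis lookup_single_eq lookup_zero zero_neq_one)
  ultimately have "ereal ((\<integral>y. mpoly_eval ?f y \<partial>P)\<^sup>2 / (\<integral>y. (mpoly_eval ?f y)\<^sup>2 \<partial>Q) - 1)
    \<le> low_degree_chi2 J D P Q" by (rule low_degree_chi2_ge)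
  moreover have "- 1 \<le> ereal ((\<integral>y. mpoly_eval ?f y \<partial>P)\<^sup>2 / (\<integral>y. (mpoly_eval ?f y)\<^sup>2 \<partial>Q) - 1)"
    by (simp add: one_ereal_def)
  ultimately show ?thesis by (rule order_trans[rotated])
qed

text \<open>The test polynomial is \<open>\<Sum>i\<in>I. w i * (\<Prod>e\<in>E i. y e)\<close> with
  \<open>w i\<close> the product of the reciprocal variances. With
  \<open>c = \<beta> / sqrt N\<close> and \<open>S\<close> the sum of the weights, its planted mean
  is \<open>c ^ d * S\<close>. In the null second moment only pairs with equal edge sets survive,
  and each contributes \<open>w i\<close>, so the total is at most \<open>S * m\<close>. One factor
  \<open>S\<close> cancels in the quotient.\<close>

lemma low_degree_chi2_ge_family:
  assumes profile: "variance_profile N \<Delta>" and N: "N \<ge> 1"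
    and nu: "prob_space \<nu>" "sets \<nu> = sets borel" and beta: "\<beta> > 0"
    and I: "finite I"
    and E: "\<And>i. i \<in> I \<Longrightarrow> E i \<subseteq> observed \<Delta> \<and> card (E i) = d" and D: "d \<le> D"
    and int: "\<And>i T. i \<in> I \<Longrightarrow> T \<subseteq> E i \<Longrightarrow>
      integrable (iid_law N \<nu>) (\<lambda>x. \<Prod>e\<in>T. x (fst e) * x (snd e))"
    and one: "\<And>i. i \<in> I \<Longrightarrow> (\<integral>x. (\<Prod>e\<in>E i. x (fst e) * x (snd e)) \<partial>iid_law N \<nu>) = 1"
    and mult: "\<And>i. i \<in> I \<Longrightarrow> card {j\<in>I. E j = E i} \<le> m"
  shows "ereal ((\<beta>\<^sup>2 / real N) ^ d * (\<Sum>i\<in>I. \<Prod>e\<in>E i. 1 / real_of_ereal (\<Delta> $$ e)) / real m - 1)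
    \<le> low_degree_chi2 (observed \<Delta>) D
        (planted_law \<Delta> (spike_signal N \<beta> (iid_law N \<nu>))) (null_law \<Delta>)"
proof (cases "I = {}")
  case True
  then show ?thesis
    using low_degree_chi2_ge_minus_one by (simp add: one_ereal_def)
next
  case False
  note I = I False
  define w where "w i = (\<Prod>e\<in>E i. 1 / real_of_ereal (\<Delta> $$ e))" for i
  define S where "S = sum w I"
  define c where "c = \<beta> / sqrt (real N)"
  define f where "f = multilinear_poly I E w"
  let ?P = "planted_law \<Delta> (spike_signal N \<beta> (iid_law N \<nu>))" and ?Q = "null_law \<Delta>"
  have fin: "finite (E i)" if "i \<in> I" for i
    using E[OF that] finite_observed[OF profile] finite_subset by blast
  have w_pos: "w i > 0" if "i \<in> I" for i
    unfolding w_def using E[OF that] observed_pos[OF profile] by (intro prod_pos) auto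
  have S_pos: "S > 0" unfolding S_def using I w_pos by (intro sum_pos) auto
  have c_pos: "c > 0" using beta N by (simp add: c_def)
  have eval: "mpoly_eval f y = (\<Sum>i\<in>I. w i * (\<Prod>e\<in>E i. y e))" for y
    unfolding f_def using fin by (rule mpoly_eval_multilinear_poly)
  have "has_bochner_integral ?P (\<lambda>y. \<Prod>e\<in>E i. y e) (c ^ d)" if "i \<in> I" for i
    using has_bochner_integral_planted_prod[OF profile nu _ int[OF that], of "E i" \<beta>] E[OF that] one[OF that]
    by (simp add: c_def)
  then have "has_bochner_integral ?P (mpoly_eval f) (\<Sum>i\<in>I. w i * c ^ d)"
    unfolding eval by (intro has_bochner_integral_sum has_bochner_integral_mult_right) auto
  then have EP: "(\<integral>y. mpoly_eval f y \<partial>?P) = c ^ d * S"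
    by (simp add: has_bochner_integral_iff S_def sum_distrib_right mult.commute[of "c ^ d"])
  have sq: "(mpoly_eval f y)\<^sup>2 =
      (\<Sum>i\<in>I. \<Sum>j\<in>I. w i * w j * ((\<Prod>e\<in>E i. y e) * (\<Prod>e\<in>E j. y e)))" for y
    unfolding eval power2_eq_square sum_product by (intro sum.cong) (auto simp: mult_ac)
  have pair: "has_bochner_integral ?Q (\<lambda>y. w i * w j * ((\<Prod>e\<in>E i. y e) * (\<Prod>e\<in>E j. y e)))
      (if E j = E i then w i else 0)" if "i \<in> I" "j \<in> I" for i j
  proof -
    have "w i * w j * (\<Prod>e\<in>E i. real_of_ereal (\<Delta> $$ e)) = w i" if "E j = E i"
    proof -
      \<comment> \<open>This is where the choice of weights enters: \<open>w j\<close> is the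
        reciprocal of the null variance of the monomial.\<close>
      have "w j * (\<Prod>e\<in>E i. real_of_ereal (\<Delta> $$ e)) = 1"
        unfolding w_def that prod.distrib[symmetric]
        using E[OF \<open>i \<in> I\<close>] observed_pos[OF profile] by (intro prod.neutral) fastforce
      then show ?thesis by (simp add: mult.assoc)
    qed
    then show ?thesis
      using integrable_null_law_prod_prod[OF profile, of "E i" "E j"]
        integral_null_law_prod_prod[OF profile, of "E i" "E j"] E that
      by (auto simp: has_bochner_integral_iff)
  qed
  have "has_bochner_integral ?Q (\<lambda>y. (mpoly_eval f y)\<^sup>2)
      (\<Sum>i\<in>I. \<Sum>j\<in>I. if E j = E i then w i else 0)"
    unfolding sq by (intro has_bochner_integral_sum pair)
  then have EQ: "(\<integral>y. (mpoly_eval f y)\<^sup>2 \<partial>?Q) = (\<Sum>i\<in>I. w i * real (card {j\<in>I. E j = E i}))"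
    using I by (simp add: has_bochner_integral_iff sum.inter_filter[symmetric] mult.commute)
  have "(\<Sum>i\<in>I. w i * real (card {j\<in>I. E j = E i})) \<le> (\<Sum>i\<in>I. w i * real m)"
    using w_pos mult by (intro sum_mono mult_left_mono) (auto simp: less_imp_le)
  then have EQ_le: "(\<integral>y. (mpoly_eval f y)\<^sup>2 \<partial>?Q) \<le> S * real m"
    by (simp add: EQ S_def sum_distrib_right)
  have EQ_pos: "0 < (\<integral>y. (mpoly_eval f y)\<^sup>2 \<partial>?Q)"
    unfolding EQ using I w_pos by (intro sum_pos mult_pos_pos) (auto simp: card_gt_0_iff)
  \<comment> \<open>The coefficients are not inspected: a vanishing polynomial would have planted
    mean 0, whereas the mean is positive.\<close>
  have "f \<noteq> 0"
  proof
    assume "f = 0"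
    then have "(\<integral>y. mpoly_eval f y \<partial>?P) = 0" by (simp add: mpoly_eval_def)
    then show False using EP c_pos S_pos by simp
  qed
  moreover have "f \<in> mpolys_le (observed \<Delta>) D"
    unfolding f_def using E fin D by (intro multilinear_poly_in_mpolys_le) auto
  ultimately have "ereal ((c ^ d * S)\<^sup>2 / (\<integral>y. (mpoly_eval f y)\<^sup>2 \<partial>?Q) - 1)
      \<le> low_degree_chi2 (observed \<Delta>) D ?P ?Q"
    using low_degree_chi2_ge[of f "observed \<Delta>" D ?P ?Q] by (simp add: EP)
  moreover have "(\<beta>\<^sup>2 / real N) ^ d * S / real m \<le> (c ^ d * S)\<^sup>2 / (\<integral>y. (mpoly_eval f y)\<^sup>2 \<partial>?Q)"
  proof -
    have "c\<^sup>2 = \<beta>\<^sup>2 / real N" by (simp add: c_def power_divide)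
    then have "(c ^ d * S)\<^sup>2 = (\<beta>\<^sup>2 / real N) ^ d * S * S"
      by (metis (no_types, lifting) mult.assoc power2_eq_square power_commutes power_mult power_mult_distrib mult.commute)
    moreover have "m > 0"
    proof (rule ccontr)
      assume "\<not> m > 0"
      then show False using EQ_le EQ_pos by simp
    qed
    ultimately have "(\<beta>\<^sup>2 / real N) ^ d * S / real m = (c ^ d * S)\<^sup>2 / (S * real m)"
      using S_pos by (simp add: field_simps)
    also have "\<dots> \<le> (c ^ d * S)\<^sup>2 / (\<integral>y. (mpoly_eval f y)\<^sup>2 \<partial>?Q)"
      using EQ_le EQ_pos by (intro divide_left_mono mult_pos_pos) (auto simp: S_pos \<open>m > 0\<close>)
    finally show ?thesis .
  qed
  ultimately show ?thesis
    unfolding w_def[symmetric] S_def[symmetric] by (meson diff_right_mono ereal_less_eq(3) order_trans)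
qed

subsection \<open>Closed walks and spectral powers\<close>

definition words :: "nat \<Rightarrow> nat \<Rightarrow> nat list set" where
  "words N n = {xs. set xs \<subseteq> {..<N} \<and> length xs = n}"

lemma finite_words [simp]: "finite (words N n)"
  unfolding words_def by (rule finite_lists_length_eq) simp

lemma words_0 [simp]: "words N 0 = {[]}"
  by (auto simp: words_def)

lemma sum_words_Suc: "(\<Sum>xs\<in>words N (Suc n). f xs) = (\<Sum>x<N. \<Sum>xs\<in>words N n. f (x # xs))"
proof -
  have "words N (Suc n) = case_prod (#) ` ({..<N} \<times> words N n)"
    by (auto simp: words_def length_Suc_conv image_iff)
  moreover have "inj_on (case_prod (#)) ({..<N} \<times> words N n)"
    by (auto simp: inj_on_def)
  ultimately show ?thesis
    by (simp add: sum.reindex sum.cartesian_product case_prod_unfold)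
qed

text \<open>Consecutive entries of the list are the steps. A closed walk is given with its first
  vertex repeated at the end; lists with fewer than two vertices have the empty product 1.\<close>

fun walk_weight :: "(nat \<Rightarrow> nat \<Rightarrow> real) \<Rightarrow> nat list \<Rightarrow> real" where
  "walk_weight a (x # y # zs) = a x y * walk_weight a (y # zs)"
| "walk_weight a _ = 1"

lemma walk_weight_append:
  "walk_weight a (us @ x # vs) = walk_weight a (us @ [x]) * walk_weight a (x # vs)"
proof (induction us)
  case (Cons u us)
  then show ?case by (cases us) auto
qed simp

lemma walk_weight_nonneg:
  assumes "\<And>i j. i < N \<Longrightarrow> j < N \<Longrightarrow> 0 \<le> a i j" "set xs \<subseteq> {..<N}"
  shows "0 \<le> walk_weight a xs"
  using assms(2)
proof (induction xs)
  case (Cons x xs)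
  then show ?case by (cases xs) (auto intro!: mult_nonneg_nonneg assms(1))
qed simp

lemma walk_weight_conv_prod:
  "walk_weight a xs = (\<Prod>k<length xs - 1. a (xs ! k) (xs ! Suc k))"
proof (induction a xs rule: walk_weight.induct)
  case (1 a x y zs)
  have "(\<Prod>k<Suc (length zs). a ((x # y # zs) ! k) ((x # y # zs) ! Suc k)) =
    a x y * (\<Prod>k<length zs. a ((y # zs) ! k) ((y # zs) ! Suc k))"
    by (subst prod.lessThan_Suc_shift) simp
  with 1 show ?case by simp
qed auto

lemma closed_walk_weight_conv_prod:
  assumes "length ys = d" "d > 0"
  shows "walk_weight a (ys @ [hd ys]) = (\<Prod>k<d. a (ys ! k) (ys ! (Suc k mod d)))"
proof -
  have "ys \<noteq> []" using assms by auto
  then have "(ys @ [hd ys]) ! Suc k = ys ! (Suc k mod d)" if "k < d" for k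
    using that assms by (cases "Suc k = d") (auto simp: nth_append hd_conv_nth)
  then show ?thesis
    unfolding walk_weight_conv_prod using assms by (intro prod.cong) (auto simp: nth_append)
qed

text \<open>All but one of the \<open>p\<close> factors are bounded by the whole sum, which
  dominates each term by nonnegativity.\<close>

lemma sum_power_le_power_sum:
  fixes f :: "'a \<Rightarrow> real"
  assumes "finite A" "\<And>x. x \<in> A \<Longrightarrow> 0 \<le> f x" "p > 0"
  shows "(\<Sum>x\<in>A. f x ^ p) \<le> (\<Sum>x\<in>A. f x) ^ p"
proof -
  obtain q where p: "p = Suc q" using assms(3) by (cases p) auto
  have "(\<Sum>x\<in>A. f x ^ p) \<le> (\<Sum>x\<in>A. f x * (\<Sum>x\<in>A. f x) ^ q)"
    unfolding p power_Suc using assms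
    by (intro sum_mono mult_left_mono power_mono member_le_sum) auto
  then show ?thesis by (simp add: p sum_distrib_right)
qed

text \<open>The matrix \<open>a\<close> is diagonalised by the orthonormal family
  \<open>u 1, ..., u N\<close>. Plain functions are used so that walk sums involve only real
  numbers; coordinates start at 0 and spectral indices at 1, as in \<open>eigval\<close>.\<close>

locale spectral_decomposition =
  fixes N :: nat and a :: "nat \<Rightarrow> nat \<Rightarrow> real" and l :: "nat \<Rightarrow> real" and u :: "nat \<Rightarrow> nat \<Rightarrow> real"
  assumes decomp: "i < N \<Longrightarrow> j < N \<Longrightarrow> a i j = (\<Sum>k=1..N. l k * (u k i * u k j))"
    and orthonormal: "k \<in> {1..N} \<Longrightarrow> k' \<in> {1..N} \<Longrightarrow>
      (\<Sum>i<N. u k i * u k' i) = (if k = k' then 1 else 0)"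
begin

text \<open>The \<open>(i, j)\<close> entry of the \<open>n\<close>-th power of the matrix
  \<open>a\<close>.\<close>

definition spectral_power :: "nat \<Rightarrow> nat \<Rightarrow> nat \<Rightarrow> real" where
  "spectral_power n i j = (\<Sum>k=1..N. l k ^ n * (u k i * u k j))"

lemma spectral_power_mult:
  "(\<Sum>z<N. spectral_power m i z * spectral_power n z j) = spectral_power (m + n) i j"
proof -
  have "(\<Sum>z<N. spectral_power m i z * spectral_power n z j) =
    (\<Sum>z<N. \<Sum>k=1..N. \<Sum>k'=1..N. (l k ^ m * u k i * l k' ^ n * u k' j) * (u k z * u k' z))"
    unfolding spectral_power_def sum_product by (intro sum.cong refl) (simp add: mult_ac)
  also have "\<dots> = (\<Sum>k=1..N. \<Sum>k'=1..N. \<Sum>z<N. (l k ^ m * u k i * l k' ^ n * u k' j) * (u k z * u k' z))"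
    by (rule trans[OF sum.swap], rule sum.cong[OF refl], rule sum.swap)
  also have "\<dots> = (\<Sum>k=1..N. \<Sum>k'=1..N. if k = k' then l k ^ m * u k i * l k' ^ n * u k' j else 0)"
    by (intro sum.cong refl) (simp only: sum_distrib_left[symmetric] orthonormal, simp)
  also have "\<dots> = spectral_power (m + n) i j"
    unfolding spectral_power_def by (intro sum.cong refl) (simp add: sum.delta' power_add mult_ac)
  finally show ?thesis .
qed

lemma spectral_power_1: "i < N \<Longrightarrow> j < N \<Longrightarrow> spectral_power (Suc 0) i j = a i j"
  by (simp add: spectral_power_def decomp)

lemma trace_spectral_power: "(\<Sum>x<N. spectral_power n x x) = (\<Sum>k=1..N. l k ^ n)"
  unfolding spectral_power_def
  by (subst sum.swap) (simp add: sum_distrib_left[symmetric] orthonormal)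

text \<open>Summing out the interior vertices is matrix multiplication. There are \<open>n\<close>
  of them, hence \<open>Suc n\<close> steps.\<close>

lemma sum_walk_weight:
  assumes "i < N" "j < N"
  shows "(\<Sum>xs\<in>words N n. walk_weight a (i # xs @ [j])) = spectral_power (Suc n) i j"
  using assms(1)
proof (induction n arbitrary: i)
  case 0
  then show ?case using assms by (simp add: spectral_power_1)
next
  case (Suc n)
  have "(\<Sum>xs\<in>words N (Suc n). walk_weight a (i # xs @ [j])) =
    (\<Sum>x<N. spectral_power (Suc 0) i x * spectral_power (Suc n) x j)"
    unfolding sum_words_Suc using Suc
    by (intro sum.cong refl) (simp add: sum_distrib_left[symmetric] spectral_power_1)
  then show ?case by (simp add: spectral_power_mult)
qed

lemma sum_closed_walk_weight:
  assumes "n > 0"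
  shows "(\<Sum>ys\<in>words N n. walk_weight a (ys @ [hd ys])) = (\<Sum>k=1..N. l k ^ n)"
proof -
  obtain m where n: "n = Suc m" using assms by (cases n) auto
  have "(\<Sum>ys\<in>words N n. walk_weight a (ys @ [hd ys])) = (\<Sum>x<N. spectral_power n x x)"
    unfolding n sum_words_Suc by (intro sum.cong refl) (simp add: sum_walk_weight)
  then show ?thesis by (simp add: trace_spectral_power)
qed

text \<open>The list \<open>us\<close> is the part of a closed walk before a marked visit to
  \<open>x\<close>, and \<open>spectral_power c\<close> stands for the arc that returns from
  \<open>x\<close> to the start. Summing over the start glues the two. For \<open>p = 0\<close> the
  start is \<open>x\<close> itself, which \<open>hd (us @ [x])\<close> covers.\<close>

lemma sum_walk_weight_hd:
  assumes "x < N"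
  shows "(\<Sum>us\<in>words N p. walk_weight a (us @ [x]) * spectral_power c x (hd (us @ [x]))) =
    spectral_power (c + p) x x"
proof (cases p)
  case (Suc q)
  have "(\<Sum>us\<in>words N p. walk_weight a (us @ [x]) * spectral_power c x (hd (us @ [x]))) =
    (\<Sum>z<N. spectral_power c x z * spectral_power p z x)"
    unfolding Suc sum_words_Suc using assms
    by (intro sum.cong refl) (simp add: sum_walk_weight sum_distrib_right[symmetric])
  then show ?thesis by (simp add: spectral_power_mult)
qed simp

text \<open>The vertex \<open>x\<close> cuts the closed walk into closed walks of lengths \<open>Suc q\<close> and \<open>Suc r + p\<close>.\<close>
lemma sum_repeated_walk_weight:
  "(\<Sum>(us, x, vs, ws)\<in>words N p \<times> {..<N} \<times> words N q \<times> words N r.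
      walk_weight a (us @ [x] @ vs @ [x] @ ws @ [hd (us @ [x])])) =
    (\<Sum>x<N. spectral_power (Suc q) x x * spectral_power (Suc r + p) x x)"
proof -
  have "(\<Sum>(us, x, vs, ws)\<in>words N p \<times> {..<N} \<times> words N q \<times> words N r.
      walk_weight a (us @ [x] @ vs @ [x] @ ws @ [hd (us @ [x])])) =
    (\<Sum>us\<in>words N p. \<Sum>x<N. \<Sum>vs\<in>words N q. \<Sum>ws\<in>words N r.
      walk_weight a (us @ [x]) * walk_weight a (x # vs @ [x]) *
      walk_weight a (x # ws @ [hd (us @ [x])]))"
  proof -
    have "walk_weight a (us @ [x] @ vs @ [x] @ ws @ [h]) =
      walk_weight a (us @ [x]) * walk_weight a (x # vs @ [x]) * walk_weight a (x # ws @ [h])"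
      for us x vs ws h
      using walk_weight_append[of a us x "vs @ [x] @ ws @ [h]"]
        walk_weight_append[of a "x # vs" x "ws @ [h]"] by simp
    then show ?thesis by (simp only: sum.cartesian_product)
  qed
  also have "\<dots> = (\<Sum>us\<in>words N p. \<Sum>x<N. walk_weight a (us @ [x]) * spectral_power (Suc q) x x *
      spectral_power (Suc r) x (hd (us @ [x])))"
  proof (intro sum.cong refl)
    fix us x assume "us \<in> words N p" "x \<in> {..<N}"
    then have "x < N" "hd (us @ [x]) < N" by (auto simp: words_def hd_append subset_eq)
    then show "(\<Sum>vs\<in>words N q. \<Sum>ws\<in>words N r.
        walk_weight a (us @ [x]) * walk_weight a (x # vs @ [x]) *
        walk_weight a (x # ws @ [hd (us @ [x])])) =
      walk_weight a (us @ [x]) * spectral_power (Suc q) x x * spectral_power (Suc r) x (hd (us @ [x]))"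
      by (simp only: sum_distrib_left[symmetric] sum_walk_weight sum_distrib_right[symmetric])
  qed
  also have "\<dots> = (\<Sum>x<N. \<Sum>us\<in>words N p. spectral_power (Suc q) x x *
      (walk_weight a (us @ [x]) * spectral_power (Suc r) x (hd (us @ [x]))))"
    by (subst sum.swap) (simp add: mult_ac)
  also have "\<dots> = (\<Sum>x<N. spectral_power (Suc q) x x * spectral_power (Suc r + p) x x)"
    by (intro sum.cong refl) (simp only: sum_distrib_left[symmetric] sum_walk_weight_hd lessThan_iff)
  finally show ?thesis .
qed

section \<open>Bounding the walks with a repeated vertex\<close>

lemma abs_spectral_power_diag_le:
  "\<bar>spectral_power n x x\<bar> \<le> (\<Sum>k=1..N. \<bar>l k\<bar> ^ n * (u k x)\<^sup>2)"
  unfolding spectral_power_def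
  by (rule order_trans[OF sum_abs]) (simp add: abs_mult power_abs power2_eq_square)

text \<open>Delocalisation is used on one factor only: its diagonal is at most
  \<open>\<delta>\<^sup>2 * t ^ p\<close> at every \<open>x\<close>, with \<open>t\<close> the sum
  of the absolute eigenvalues. For the other factor the sum over \<open>x\<close> is carried out
  exactly by \<open>(\<Sum>x<N. (u k x)\<^sup>2) = 1\<close>. Thus no factor \<open>N\<close>
  appears.\<close>

lemma sum_spectral_power_diag_mult_le:
  assumes "p > 0" "q > 0" and \<delta>: "\<And>k x. k \<in> {1..N} \<Longrightarrow> x < N \<Longrightarrow> \<bar>u k x\<bar> \<le> \<delta>"
  shows "(\<Sum>x<N. spectral_power p x x * spectral_power q x x) \<le> \<delta>\<^sup>2 * (\<Sum>k=1..N. \<bar>l k\<bar>) ^ (p + q)"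
proof -
  let ?t = "\<Sum>k=1..N. \<bar>l k\<bar>"
  have t: "?t \<ge> 0" by (intro sum_nonneg) auto
  have "\<bar>spectral_power p x x\<bar> \<le> \<delta>\<^sup>2 * ?t ^ p" if "x < N" for x
  proof -
    have "(\<Sum>k=1..N. \<bar>l k\<bar> ^ p * (u k x)\<^sup>2) \<le> (\<Sum>k=1..N. \<bar>l k\<bar> ^ p * \<delta>\<^sup>2)"
    proof (intro sum_mono mult_left_mono)
      fix k assume "k \<in> {1..N}"
      from power_mono[OF \<delta>[OF this that], of 2] show "(u k x)\<^sup>2 \<le> \<delta>\<^sup>2" by simp
    qed auto
    also have "\<dots> \<le> ?t ^ p * \<delta>\<^sup>2"
      unfolding sum_distrib_right[symmetric] using assms(1)
      by (intro mult_right_mono sum_power_le_power_sum) auto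
    finally show ?thesis using abs_spectral_power_diag_le[of p x] by (simp add: mult.commute)
  qed
  then have "\<bar>spectral_power p x x\<bar> * \<bar>spectral_power q x x\<bar>
      \<le> \<delta>\<^sup>2 * ?t ^ p * (\<Sum>k=1..N. \<bar>l k\<bar> ^ q * (u k x)\<^sup>2)" if "x < N" for x
    using abs_spectral_power_diag_le[of q x] that t by (intro mult_mono) auto
  then have "spectral_power p x x * spectral_power q x x
      \<le> \<delta>\<^sup>2 * ?t ^ p * (\<Sum>k=1..N. \<bar>l k\<bar> ^ q * (u k x)\<^sup>2)" if "x < N" for x
    using that abs_ge_self[of "spectral_power p x x * spectral_power q x x"]
    unfolding abs_mult by fastforce
  then have "(\<Sum>x<N. spectral_power p x x * spectral_power q x x) \<le>
      (\<Sum>x<N. \<delta>\<^sup>2 * ?t ^ p * (\<Sum>k=1..N. \<bar>l k\<bar> ^ q * (u k x)\<^sup>2))"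
    by (intro sum_mono) auto
  also have "\<dots> = \<delta>\<^sup>2 * ?t ^ p * (\<Sum>k=1..N. \<bar>l k\<bar> ^ q)"
    unfolding sum_distrib_left[symmetric]
    by (subst sum.swap) (simp add: sum_distrib_left[symmetric] power2_eq_square orthonormal)
  also have "\<dots> \<le> \<delta>\<^sup>2 * ?t ^ p * ?t ^ q"
    using assms(2) t by (intro mult_left_mono sum_power_le_power_sum) auto
  finally show ?thesis by (simp add: power_add mult_ac)
qed

text \<open>All closed walks together weigh the sum of the \<open>d\<close>-th powers of the
  eigenvalues, and from this the walks with a repeated vertex are subtracted. Such a walk has the
  form \<open>us @ [x] @ vs @ [x] @ ws\<close>, perhaps in several ways; as weights are nonnegative,
  overcounting only enlarges the subtracted amount.\<close>

lemma sum_distinct_closed_walks_ge: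
  assumes nonneg: "\<And>i j. i < N \<Longrightarrow> j < N \<Longrightarrow> 0 \<le> a i j"
    and d: "even d" "d > 0" and k: "k \<in> {1..N}"
    and \<delta>: "\<And>k x. k \<in> {1..N} \<Longrightarrow> x < N \<Longrightarrow> \<bar>u k x\<bar> \<le> \<delta>"
  shows "l k ^ d - (real d)\<^sup>2 * \<delta>\<^sup>2 * (\<Sum>k=1..N. \<bar>l k\<bar>) ^ d
    \<le> (\<Sum>ys | ys \<in> words N d \<and> distinct ys. walk_weight a (ys @ [hd ys]))"
proof -
  let ?t = "\<Sum>k=1..N. \<bar>l k\<bar>"
  let ?w = "\<lambda>ys. walk_weight a (ys @ [hd ys])"
  let ?R = "\<lambda>(us, x, vs, ws). us @ [x] @ vs @ [x] @ ws :: nat list"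
  \<comment> \<open>The lengths of \<open>us\<close>, \<open>vs\<close> and \<open>ws\<close>; the 2
    counts the two visits to \<open>x\<close>.\<close>
  let ?L = "{(p, q, r). p + q + r + 2 = d}"
  let ?W = "\<lambda>(p, q, r). words N p \<times> {..<N} \<times> words N q \<times> words N r"
  let ?X = "{ys. ys \<in> words N d \<and> \<not> distinct ys}"
  have L: "finite ?L" "real (card ?L) \<le> (real d)\<^sup>2"
  proof -
    have sub: "?L \<subseteq> (\<lambda>(p, q). (p, q, d - 2 - p - q)) ` ({..<d} \<times> {..<d})" by (force simp: image_iff)
    show "finite ?L" by (rule finite_subset[OF sub]) auto
    have "card ?L \<le> card ({..<d} \<times> {..<d})"
      by (rule order_trans[OF card_mono[OF _ sub] card_image_le]) auto
    then have "real (card ?L) \<le> real (d * d)" unfolding of_nat_le_iff by simp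
    then show "real (card ?L) \<le> (real d)\<^sup>2" by (simp add: power2_eq_square)
  qed
  have w_nonneg: "0 \<le> ?w ys" if "ys \<in> words N d" for ys
  proof -
    have "ys \<noteq> []" "set ys \<subseteq> {..<N}" using that d by (auto simp: words_def)
    then show ?thesis
      by (intro walk_weight_nonneg[of N] nonneg) (auto dest: hd_in_set)
  qed
  have "?X \<subseteq> (\<Union>m\<in>?L. ?R ` ?W m)"
  proof
    fix ys assume ys: "ys \<in> ?X"
    then obtain us vs ws x where "ys = us @ [x] @ vs @ [x] @ ws"
      using not_distinct_decomp by blast
    with ys have "(length us, length vs, length ws) \<in> ?L" "ys \<in> ?R ` ?W (length us, length vs, length ws)"
      by (auto simp: words_def image_iff intro!: bexI[of _ "(us, x, vs, ws)"])
    then show "ys \<in> (\<Union>m\<in>?L. ?R ` ?W m)" by blast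
  qed
  moreover have RW: "?R ` ?W m \<subseteq> words N d" if "m \<in> ?L" for m
    using that by (auto simp: words_def)
  ultimately have "sum ?w ?X \<le> sum ?w (\<Union>m\<in>?L. ?R ` ?W m)"
  proof (intro sum_mono2)
    show "finite (\<Union>m\<in>?L. ?R ` ?W m)" using L(1) by (auto split: prod.splits)
    show "0 \<le> ?w ys" if "ys \<in> (\<Union>m\<in>?L. ?R ` ?W m) - ?X" for ys
      using that RW by (intro w_nonneg) blast
  qed
  also have "\<dots> \<le> (\<Sum>m\<in>?L. sum ?w (?R ` ?W m))"
    using RW w_nonneg
  proof -
    \<comment> \<open>Subadditivity over a union, by induction: the overlap has nonnegative
      weight.\<close>
    have "sum ?w (\<Union>m\<in>M. ?R ` ?W m) \<le> (\<Sum>m\<in>M. sum ?w (?R ` ?W m))" if "finite M" "M \<subseteq> ?L" for M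
      using that
    proof (induction M rule: finite_induct)
      case (insert m M)
      have fin: "finite (?R ` ?W m)" "finite (\<Union>m\<in>M. ?R ` ?W m)"
        using insert by (auto split: prod.splits)
      have "0 \<le> sum ?w (?R ` ?W m \<inter> (\<Union>m\<in>M. ?R ` ?W m))"
        using RW insert.prems by (intro sum_nonneg w_nonneg) blast
      then show ?case
        using insert sum_Un[OF fin, of ?w] by simp
    qed simp
    then show ?thesis using L(1) by blast
  qed
  also have "\<dots> \<le> (\<Sum>m\<in>?L. \<delta>\<^sup>2 * ?t ^ d)"
  proof (rule sum_mono)
    fix m assume m: "m \<in> ?L"
    obtain p q r where pqr: "m = (p, q, r)" by (cases m)
    have d_eq: "Suc q + (Suc r + p) = d" using m pqr by simp
    have "sum ?w (?R ` ?W m) \<le> sum (?w \<circ> ?R) (?W m)"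
          proof (rule sum_image_le)
      show "0 \<le> ?w (?R z)" if "z \<in> ?W m" for z
        using that RW[OF m] by (intro w_nonneg) blast
    qed (simp add: pqr)
    also have "\<dots> = (\<Sum>x<N. spectral_power (Suc q) x x * spectral_power (Suc r + p) x x)"
      unfolding sum_repeated_walk_weight[symmetric] pqr
      by (intro sum.cong) (auto simp: hd_append)
    also have "\<dots> \<le> \<delta>\<^sup>2 * ?t ^ d"
      using sum_spectral_power_diag_mult_le[of "Suc q" "Suc r + p" \<delta>, OF _ _ \<delta>] unfolding d_eq by simp
    finally show "sum ?w (?R ` ?W m) \<le> \<delta>\<^sup>2 * ?t ^ d" .
  qed
  also have "\<dots> \<le> (real d)\<^sup>2 * (\<delta>\<^sup>2 * ?t ^ d)"
    using L(2) by (simp only: sum_constant) (intro mult_right_mono, auto intro!: mult_nonneg_nonneg zero_le_power sum_nonneg)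
  finally have X: "sum ?w ?X \<le> (real d)\<^sup>2 * \<delta>\<^sup>2 * ?t ^ d" by (simp add: mult_ac)
  \<comment> \<open>Evenness of \<open>d\<close> makes every term of the sum nonnegative, so a
    single term is at most the sum.\<close>
  have "l k ^ d \<le> (\<Sum>k=1..N. l k ^ d)"
    using k d by (intro member_le_sum) (auto simp: zero_le_even_power)
  also have "\<dots> = sum ?w (words N d)"
    using sum_closed_walk_weight[OF d(2)] by simp
  also have "words N d = {ys. ys \<in> words N d \<and> distinct ys} \<union> ?X" by auto
  also have "sum ?w \<dots> = sum ?w {ys. ys \<in> words N d \<and> distinct ys} + sum ?w ?X"
    by (rule sum.union_disjoint) (auto intro: finite_subset[OF _ finite_words[of N d]])
  finally show ?thesis using X by simp
qed

end

subsection \<open>Cycles as edge sets\<close>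

text \<open>The set \<open>observed\<close> contains only pairs with \<open>i \<le> j\<close>, so an
  undirected edge is named by its increasing pair.\<close>

definition sorted_edge :: "nat \<Rightarrow> nat \<Rightarrow> nat \<times> nat" where
  "sorted_edge i j = (min i j, max i j)"

lemma sorted_edge_eq_iff:
  "sorted_edge i j = sorted_edge i' j' \<longleftrightarrow> i = i' \<and> j = j' \<or> i = j' \<and> j = i'"
  by (auto simp: sorted_edge_def min_def max_def split: if_splits)

lemma sorted_edge_mult:
  fixes x :: "nat \<Rightarrow> real"
  shows "x (fst (sorted_edge i j)) * x (snd (sorted_edge i j)) = x i * x j"
  by (auto simp: sorted_edge_def min_def max_def)

definition cycle_edge :: "nat list \<Rightarrow> nat \<Rightarrow> nat \<times> nat" where
  "cycle_edge ys k = sorted_edge (ys ! k) (ys ! (Suc k mod length ys))"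

definition cycle_edges :: "nat list \<Rightarrow> (nat \<times> nat) set" where
  "cycle_edges ys = cycle_edge ys ` {..<length ys}"

text \<open>If two different positions gave the same edge, each would be the cyclic successor of the
  other, which forces length 2.\<close>

lemma inj_on_cycle_edge:
  assumes "distinct ys" "length ys \<ge> 3"
  shows "inj_on (cycle_edge ys) {..<length ys}"
proof (rule inj_onI)
  let ?d = "length ys"
  fix k m assume km: "k \<in> {..<?d}" "m \<in> {..<?d}" "cycle_edge ys k = cycle_edge ys m"
  then have "ys ! k = ys ! m \<or> ys ! k = ys ! (Suc m mod ?d) \<and> ys ! (Suc k mod ?d) = ys ! m"
    by (auto simp: cycle_edge_def sorted_edge_eq_iff)
  moreover have "Suc m mod ?d < ?d" "Suc k mod ?d < ?d" using assms(2) by (auto intro!: mod_less_divisor)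
  ultimately have "k = m \<or> k = Suc m mod ?d \<and> Suc k mod ?d = m"
    using km assms by (auto simp: nth_eq_iff_index_eq)
  moreover have "Suc m mod ?d = (if Suc m = ?d then 0 else Suc m)"
    "Suc k mod ?d = (if Suc k = ?d then 0 else Suc k)" using km by auto
  ultimately show "k = m" using assms(2) by (auto split: if_splits)
qed

lemma card_cycle_edges:
  assumes "distinct ys" "length ys \<ge> 3"
  shows "card (cycle_edges ys) = length ys"
  unfolding cycle_edges_def using inj_on_cycle_edge[OF assms] by (simp add: card_image)

text \<open>A cycle can be traced from its edge set: given the previous and the current vertex, the
  only other edge at the current vertex leads to the next one. The first two vertices fix the start
  and the direction.\<close>

lemma cycle_edges_eq_imp_eq:
  assumes "distinct ys" "distinct zs" "length ys = d" "length zs = d" "d \<ge> 3"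
    and edges: "cycle_edges ys = cycle_edges zs"
    and start: "ys ! 0 = zs ! 0" "ys ! 1 = zs ! 1"
  shows "ys = zs"
proof -
  have "ys ! k = zs ! k \<and> ys ! Suc k = zs ! Suc k" if "Suc k < d" for k
    using that
  proof (induction k)
    case 0
    then show ?case using start by simp
  next
    case (Suc k)
    then have IH: "ys ! k = zs ! k" "ys ! Suc k = zs ! Suc k" by auto
    have "cycle_edge ys (Suc k) \<in> cycle_edges zs"
      using Suc.prems assms by (auto simp: edges[symmetric] cycle_edges_def)
    then obtain m where m: "m < d" "cycle_edge ys (Suc k) = cycle_edge zs m"
      using assms by (auto simp: cycle_edges_def)
    have md: "Suc m mod d < d" using assms(5) by auto
    have "zs ! Suc k = zs ! m \<and> ys ! Suc (Suc k) = zs ! (Suc m mod d) \<or>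
      zs ! Suc k = zs ! (Suc m mod d) \<and> ys ! Suc (Suc k) = zs ! m"
      using m(2) Suc.prems assms IH by (auto simp: cycle_edge_def sorted_edge_eq_iff)
    then have "Suc k = m \<and> ys ! Suc (Suc k) = zs ! (Suc m mod d) \<or>
      Suc k = Suc m mod d \<and> ys ! Suc (Suc k) = zs ! m"
      using m(1) md Suc.prems assms by (auto simp: nth_eq_iff_index_eq)
    then show ?case
    proof
      assume "Suc k = m \<and> ys ! Suc (Suc k) = zs ! (Suc m mod d)"
      then show ?thesis using IH Suc.prems by auto
    next
      \<comment> \<open>Here the edge is the one just traversed, so the walk would step back to
        \<open>ys ! k\<close>, against distinctness.\<close>
      assume *: "Suc k = Suc m mod d \<and> ys ! Suc (Suc k) = zs ! m"
      then have "k = m" using m(1) by (cases "Suc m = d") auto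
      with * have "ys ! Suc (Suc k) = ys ! k" using IH by simp
      then show ?thesis using Suc.prems assms by (auto simp: nth_eq_iff_index_eq)
    qed
  qed
  then have "ys ! k = zs ! k" if "k < d" for k
    using that assms(5) by (cases k) auto
  then show ?thesis using assms by (intro nth_equalityI) auto
qed

text \<open>A traversal is determined by its first two vertices, and both lie on \<open>ys\<close>.
  This crude count costs only a factor polynomial in \<open>d\<close>, to be set against exponential
  growth in \<open>d\<close>.\<close>

lemma
  assumes "distinct ys" "length ys = d" "d \<ge> 3"
  shows finite_same_cycle_edges: "finite {zs. distinct zs \<and> length zs = d \<and> cycle_edges zs = cycle_edges ys}"
    and card_same_cycle_edges_le: "card {zs. distinct zs \<and> length zs = d \<and> cycle_edges zs = cycle_edges ys} \<le> d\<^sup>2"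
proof -
  let ?Z = "{zs. distinct zs \<and> length zs = d \<and> cycle_edges zs = cycle_edges ys}"
  let ?h = "\<lambda>zs :: nat list. (zs ! 0, zs ! 1)"
  have mem: "{fst e, snd e} \<subseteq> set ys" if "e \<in> cycle_edges ys" for e
    using that assms
    by (auto simp: cycle_edges_def cycle_edge_def sorted_edge_def min_def max_def intro!: nth_mem mod_less_divisor)
  have "?h zs \<in> set ys \<times> set ys" if zs: "zs \<in> ?Z" for zs
  proof -
    have "cycle_edge zs 0 \<in> cycle_edges zs" using zs assms by (auto simp: cycle_edges_def)
    then have "cycle_edge zs 0 \<in> cycle_edges ys" using zs by simp
    moreover have "{fst (cycle_edge zs 0), snd (cycle_edge zs 0)} = {zs ! 0, zs ! 1}"
      using zs assms by (auto simp: cycle_edge_def sorted_edge_def min_def max_def)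
    ultimately show ?thesis using mem[of "cycle_edge zs 0"] by auto
  qed
  then have sub: "?h ` ?Z \<subseteq> set ys \<times> set ys" by blast
  have inj: "inj_on ?h ?Z"
    using cycle_edges_eq_imp_eq[OF _ _ _ _ assms(3)] by (intro inj_onI) auto
  show "finite ?Z" by (rule inj_on_finite[OF inj sub]) simp
  have "card ?Z \<le> card (set ys \<times> set ys)" by (rule card_inj_on_le[OF inj sub]) simp
  also have "\<dots> = d\<^sup>2" using assms by (simp add: distinct_card power2_eq_square)
  finally show "card ?Z \<le> d\<^sup>2" .
qed

subsection \<open>Cycle and trace tests\<close>

lemma
  assumes nu: "prob_space \<nu>" "sets \<nu> = sets borel" and b: "(\<integral>x. x\<^sup>2 \<partial>\<nu>) = 1"
    and A: "A \<subseteq> {..<N}"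
  shows integrable_iid_prod_squares: "integrable (iid_law N \<nu>) (\<lambda>x. \<Prod>i\<in>A. (x i)\<^sup>2)"
    and integral_iid_prod_squares: "(\<integral>x. (\<Prod>i\<in>A. (x i)\<^sup>2) \<partial>iid_law N \<nu>) = 1"
proof -
  interpret nu: prob_space \<nu> by (rule nu(1))
  interpret product_prob_space "\<lambda>_. \<nu>" ..
  define g :: "nat \<Rightarrow> real \<Rightarrow> real" where "g i t = (if i \<in> A then t\<^sup>2 else 1)" for i t
  \<comment> \<open>A Bochner integral that does not exist is 0, so the value 1 in \<open>b\<close>
    already gives integrability.\<close>
  have "integrable \<nu> (\<lambda>x. x\<^sup>2)" using b not_integrable_integral_eq by fastforce
  then have int: "integrable \<nu> (g i)" and val: "integral\<^sup>L \<nu> (g i) = 1" for i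
    using b by (cases "i \<in> A", auto simp: g_def[abs_def] nu.prob_space)+
  have prod_g: "(\<Prod>i\<in>A. (x i)\<^sup>2) = (\<Prod>i<N. g i (x i))" for x
    unfolding g_def using A by (simp add: prod.inter_restrict[symmetric] Int_absorb1)
  show "integrable (iid_law N \<nu>) (\<lambda>x. \<Prod>i\<in>A. (x i)\<^sup>2)"
    unfolding prod_g iid_law_def by (rule product_integrable_prod) (auto intro: int)
  show "(\<integral>x. (\<Prod>i\<in>A. (x i)\<^sup>2) \<partial>iid_law N \<nu>) = 1"
    unfolding prod_g iid_law_def by (subst product_integral_prod) (auto intro: int simp: val)
qed

text \<open>The maps \<open>f\<close> and \<open>g\<close> give the two endpoints of each edge. If
  \<open>p\<close> and \<open>q\<close> are the products over the two kinds of endpoints, then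
  \<open>\<bar>p * q\<bar> \<le> p\<^sup>2 + q\<^sup>2\<close>; injectivity makes both squares
  products over distinct coordinates, integrable by independence.\<close>

lemma integrable_iid_prod_mult:
  assumes nu: "prob_space \<nu>" "sets \<nu> = sets borel" and b: "(\<integral>x. x\<^sup>2 \<partial>\<nu>) = 1"
    and f: "inj_on f K" "f ` K \<subseteq> {..<N}" and g: "inj_on g K" "g ` K \<subseteq> {..<N}"
  shows "integrable (iid_law N \<nu>) (\<lambda>x. \<Prod>k\<in>K. x (f k) * x (g k))"
proof -
  have [measurable_cong]: "sets (iid_law N \<nu>) = sets (\<Pi>\<^sub>M i\<in>{..<N}. borel)"
    unfolding iid_law_def by (intro sets_PiM_cong) (auto simp: nu)
  have meas: "(\<lambda>x. \<Prod>k\<in>K. x (f k) * x (g k)) \<in> borel_measurable (iid_law N \<nu>)"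
  proof (rule borel_measurable_prod)
    fix k assume "k \<in> K"
    then have "f k \<in> {..<N}" "g k \<in> {..<N}" using f g by auto
    then show "(\<lambda>x. x (f k) * x (g k)) \<in> borel_measurable (iid_law N \<nu>)" by measurable
  qed
  have "integrable (iid_law N \<nu>) (\<lambda>x. (\<Prod>i\<in>f ` K. (x i)\<^sup>2) + (\<Prod>i\<in>g ` K. (x i)\<^sup>2))"
    using integrable_iid_prod_squares[OF nu b] f g by auto
  then show ?thesis
  proof (rule Bochner_Integration.integrable_bound[OF _ meas])
    show "AE x in iid_law N \<nu>. norm (\<Prod>k\<in>K. x (f k) * x (g k)) \<le>
      norm ((\<Prod>i\<in>f ` K. (x i)\<^sup>2) + (\<Prod>i\<in>g ` K. (x i)\<^sup>2))"
    proof (intro AE_I2)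
      fix x :: "nat \<Rightarrow> real"
      let ?p = "\<Prod>k\<in>K. x (f k)" and ?q = "\<Prod>k\<in>K. x (g k)"
      have "\<bar>?p * ?q\<bar> \<le> ?p\<^sup>2 + ?q\<^sup>2"
        using sum_squares_bound[of "\<bar>?p\<bar>" "\<bar>?q\<bar>"] mult_nonneg_nonneg[OF abs_ge_zero[of ?p] abs_ge_zero[of ?q]]
        unfolding abs_mult power2_abs by linarith
      then show "norm (\<Prod>k\<in>K. x (f k) * x (g k)) \<le>
        norm ((\<Prod>i\<in>f ` K. (x i)\<^sup>2) + (\<Prod>i\<in>g ` K. (x i)\<^sup>2))"
        using f(1) g(1) by (simp add: prod.distrib prod.reindex prod_power_distrib)
    qed
  qed
qed

text \<open>Each coordinate of the common image occurs once as \<open>f k\<close> and once as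
  \<open>g k\<close>, hence squared in total.\<close>

lemma integral_iid_prod_mult:
  assumes nu: "prob_space \<nu>" "sets \<nu> = sets borel" and b: "(\<integral>x. x\<^sup>2 \<partial>\<nu>) = 1"
    and f: "inj_on f K" "f ` K \<subseteq> {..<N}" and g: "inj_on g K" "g ` K = f ` K"
  shows "(\<integral>x. (\<Prod>k\<in>K. x (f k) * x (g k)) \<partial>iid_law N \<nu>) = 1"
proof -
  have "(\<Prod>k\<in>K. x (f k) * x (g k)) = (\<Prod>i\<in>f ` K. (x i)\<^sup>2)" for x :: "nat \<Rightarrow> real"
  proof -
    have "(\<Prod>k\<in>K. x (f k)) = prod x (f ` K)" "(\<Prod>k\<in>K. x (g k)) = prod x (f ` K)"
      using prod.reindex[OF f(1), of x] prod.reindex[OF g(1), of x] g(2) by auto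
    then show ?thesis by (simp add: prod.distrib power2_eq_square)
  qed
  then show ?thesis using integral_iid_prod_squares[OF nu b f(2)] by simp
qed

section \<open>The two tests in terms of the reciprocal profile\<close>

lemma recip_profile_index:
  assumes "variance_profile N \<Delta>" "i < N" "j < N"
  shows "recip_profile \<Delta> $$ (i, j) =
    (if sorted_edge i j \<in> observed \<Delta> then 1 / real_of_ereal (\<Delta> $$ sorted_edge i j) else 0)"
proof -
  have dim: "\<Delta> \<in> carrier_mat N N" "transpose_mat \<Delta> = \<Delta>"
    using assms by (auto simp: variance_profile_def symmetric_matrix_def)
  have "\<Delta> $$ (j, i) = \<Delta> $$ (i, j)"
    using arg_cong[OF dim(2), of "\<lambda>A. A $$ (i, j)"] dim(1) assms by auto
  then have sym: "\<Delta> $$ sorted_edge i j = \<Delta> $$ (i, j)"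
    by (auto simp: sorted_edge_def min_def max_def)
  have obs: "sorted_edge i j \<in> observed \<Delta> \<longleftrightarrow> \<Delta> $$ (i, j) \<noteq> \<infinity>"
    using dim assms sym by (auto simp: observed_def sorted_edge_def)
  have idx: "recip_profile \<Delta> $$ (i, j) = real_of_ereal (1 / \<Delta> $$ (i, j))"
    using dim assms by (auto simp: recip_profile_def)
  show ?thesis
  proof (cases "\<Delta> $$ (i, j) = \<infinity>")
    case True
    then show ?thesis using obs idx by simp
  next
    case False
    moreover have "0 < \<Delta> $$ (i, j)" using assms by (auto simp: variance_profile_def)
    ultimately obtain r where "\<Delta> $$ (i, j) = ereal r" "r > 0"
      by (cases "\<Delta> $$ (i, j)") auto
    then show ?thesis using obs idx sym by (simp add: one_ereal_def)
  qed
qed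

lemma recip_profile_nonneg:
  assumes "variance_profile N \<Delta>" "i < N" "j < N"
  shows "0 \<le> recip_profile \<Delta> $$ (i, j)"
  using less_imp_le[OF observed_pos[OF assms(1), of "sorted_edge i j"]]
  by (simp add: recip_profile_index[OF assms])

text \<open>The test has degree 1: the family consists of the diagonal edge sets
  \<open>{(i, i)}\<close>, with multiplicity 1. A diagonal signal entry is proportional to
  \<open>(x i)\<^sup>2\<close> and so has nonzero mean.\<close>

lemma low_degree_chi2_ge_trace:
  assumes profile: "variance_profile N \<Delta>" and N: "N \<ge> 1"
    and nu: "prob_space \<nu>" "sets \<nu> = sets borel" and b: "(\<integral>x. x\<^sup>2 \<partial>\<nu>) = 1"
    and beta: "\<beta> > 0" and D: "D \<ge> 1"
  shows "ereal (\<beta>\<^sup>2 * ((\<Sum>i<N. recip_profile \<Delta> $$ (i, i)) / real N) - 1)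
    \<le> low_degree_chi2 (observed \<Delta>) D
        (planted_law \<Delta> (spike_signal N \<beta> (iid_law N \<nu>))) (null_law \<Delta>)"
proof -
  let ?I = "{i. i < N \<and> (i, i) \<in> observed \<Delta>}"
  have "(\<Sum>i<N. recip_profile \<Delta> $$ (i, i)) = (\<Sum>i<N. if (i, i) \<in> observed \<Delta> then 1 / real_of_ereal (\<Delta> $$ (i, i)) else 0)"
    by (intro sum.cong) (auto simp: recip_profile_index[OF profile] sorted_edge_def)
  also have "\<dots> = (\<Sum>i\<in>?I. \<Prod>e\<in>{(i, i)}. 1 / real_of_ereal (\<Delta> $$ e))"
    by (simp add: sum.inter_filter[symmetric])
  finally have trace: "(\<Sum>i<N. recip_profile \<Delta> $$ (i, i)) = \<dots>" .
  have "ereal ((\<beta>\<^sup>2 / real N) ^ 1 * (\<Sum>i\<in>?I. \<Prod>e\<in>{(i, i)}. 1 / real_of_ereal (\<Delta> $$ e)) / real 1 - 1)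
    \<le> low_degree_chi2 (observed \<Delta>) D
        (planted_law \<Delta> (spike_signal N \<beta> (iid_law N \<nu>))) (null_law \<Delta>)"
  proof (rule low_degree_chi2_ge_family[OF profile N nu beta _ _ D])
    show "integrable (iid_law N \<nu>) (\<lambda>x. \<Prod>e\<in>T. x (fst e) * x (snd e))"
      if "i \<in> ?I" "T \<subseteq> {(i, i)}" for i T
      using that by (intro integrable_iid_prod_mult[OF nu b]) (auto simp: inj_on_def)
    show "(\<integral>x. (\<Prod>e\<in>{(i, i)}. x (fst e) * x (snd e)) \<partial>iid_law N \<nu>) = 1" if "i \<in> ?I" for i
      using that by (intro integral_iid_prod_mult[OF nu b]) auto
    show "card {j \<in> ?I. {(j, j)} = {(i, i)}} \<le> 1" for i
      using card_mono[of "{i}" "{j \<in> ?I. {(j, j)} = {(i, i)}}"] by auto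
  qed auto
  then show ?thesis unfolding trace by simp
qed

text \<open>The family consists of the cyclic vertex sequences whose edges are all observed; the
  others have weight 0. Every vertex of a cycle ends one edge and starts another, so the signal
  product is a product of squares with mean 1. The divisor \<open>(real d)\<^sup>2\<close> accounts
  for different sequences with the same edge set.\<close>

lemma low_degree_chi2_ge_cycles:
  assumes profile: "variance_profile N \<Delta>" and N: "N \<ge> 1"
    and nu: "prob_space \<nu>" "sets \<nu> = sets borel" and b: "(\<integral>x. x\<^sup>2 \<partial>\<nu>) = 1"
    and beta: "\<beta> > 0" and d: "d \<ge> 3" "d \<le> D"
  shows "ereal ((\<beta>\<^sup>2 / real N) ^ d *
        (\<Sum>ys | ys \<in> words N d \<and> distinct ys.
          walk_weight (\<lambda>i j. recip_profile \<Delta> $$ (i, j)) (ys @ [hd ys])) / (real d)\<^sup>2 - 1)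
    \<le> low_degree_chi2 (observed \<Delta>) D
        (planted_law \<Delta> (spike_signal N \<beta> (iid_law N \<nu>))) (null_law \<Delta>)"
proof -
  let ?C = "{ys. ys \<in> words N d \<and> distinct ys}"
  let ?I = "{ys \<in> ?C. cycle_edges ys \<subseteq> observed \<Delta>}"
  have fin: "finite ?C" by (rule finite_subset[OF _ finite_words[of N d]]) auto
  have nth: "ys ! k < N" if "ys \<in> ?C" "k < d" for ys k
    using that nth_mem[of k ys] by (auto simp: words_def subset_eq)
  have Suc_mod: "Suc k mod d < d" for k using d by auto
  have weight: "walk_weight (\<lambda>i j. recip_profile \<Delta> $$ (i, j)) (ys @ [hd ys]) =
      (if cycle_edges ys \<subseteq> observed \<Delta> then \<Prod>e\<in>cycle_edges ys. 1 / real_of_ereal (\<Delta> $$ e) else 0)"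
    if ys: "ys \<in> ?C" for ys
  proof -
    have len: "length ys = d" "distinct ys" using ys by (auto simp: words_def)
    have "walk_weight (\<lambda>i j. recip_profile \<Delta> $$ (i, j)) (ys @ [hd ys]) =
      (\<Prod>k<d. if cycle_edge ys k \<in> observed \<Delta> then 1 / real_of_ereal (\<Delta> $$ cycle_edge ys k) else 0)"
      using d len nth[OF ys] Suc_mod
      by (subst closed_walk_weight_conv_prod[of _ d])
         (auto intro!: prod.cong simp: recip_profile_index[OF profile] cycle_edge_def)
    also have "\<dots> = (\<Prod>e\<in>cycle_edges ys. if e \<in> observed \<Delta> then 1 / real_of_ereal (\<Delta> $$ e) else 0)"
      unfolding cycle_edges_def using inj_on_cycle_edge[of ys] len d by (simp add: prod.reindex)
    also have "\<dots> = (if cycle_edges ys \<subseteq> observed \<Delta> then \<Prod>e\<in>cycle_edges ys. 1 / real_of_ereal (\<Delta> $$ e) else 0)"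
    proof (cases "cycle_edges ys \<subseteq> observed \<Delta>")
      case True
      then show ?thesis by (auto intro!: prod.cong)
    next
      case False
      then show ?thesis by (auto simp: cycle_edges_def intro!: prod_zero)
    qed
    finally show ?thesis .
  qed
  have total: "(\<Sum>ys\<in>?C. walk_weight (\<lambda>i j. recip_profile \<Delta> $$ (i, j)) (ys @ [hd ys])) =
      (\<Sum>ys\<in>?I. \<Prod>e\<in>cycle_edges ys. 1 / real_of_ereal (\<Delta> $$ e))"
    using fin by (subst sum.cong[OF refl weight]) (auto simp: sum.inter_filter[symmetric])
  have "ereal ((\<beta>\<^sup>2 / real N) ^ d * (\<Sum>ys\<in>?I. \<Prod>e\<in>cycle_edges ys. 1 / real_of_ereal (\<Delta> $$ e)) / real (d\<^sup>2) - 1)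
    \<le> low_degree_chi2 (observed \<Delta>) D
        (planted_law \<Delta> (spike_signal N \<beta> (iid_law N \<nu>))) (null_law \<Delta>)"
  proof (rule low_degree_chi2_ge_family[OF profile N nu beta _ _ d(2)])
    show "finite ?I" using fin by simp
    fix ys assume "ys \<in> ?I"
    then have ys: "ys \<in> ?C" "cycle_edges ys \<subseteq> observed \<Delta>" "length ys = d" "distinct ys"
      by (auto simp: words_def)
    show "cycle_edges ys \<subseteq> observed \<Delta> \<and> card (cycle_edges ys) = d"
      using ys card_cycle_edges[of ys] d by simp
    have "card {zs \<in> ?I. cycle_edges zs = cycle_edges ys} \<le>
        card {zs. distinct zs \<and> length zs = d \<and> cycle_edges zs = cycle_edges ys}"
      using ys d by (intro card_mono finite_same_cycle_edges) (auto simp: words_def)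
    then show "card {zs \<in> ?I. cycle_edges zs = cycle_edges ys} \<le> d\<^sup>2"
      using card_same_cycle_edges_le[of ys d] ys d by simp
    \<comment> \<open>For a proper subset of the edges only integrability is claimed, and this rests
      on both endpoint maps being injective.\<close>
    have inj: "inj_on (nth ys) K" "inj_on (\<lambda>k. ys ! (Suc k mod d)) K" if "K \<subseteq> {..<d}" for K
    proof -
      have "inj_on (\<lambda>k. Suc k mod d) {..<d}"
        by (rule inj_onI) (auto simp: mod_Suc split: if_splits)
      moreover have "inj_on (nth ys) {..<d}" using ys by (simp add: inj_on_nth)
      ultimately have "inj_on (nth ys \<circ> (\<lambda>k. Suc k mod d)) {..<d}"
        using Suc_mod by (intro comp_inj_on) (auto intro: inj_on_subset)
      then show "inj_on (nth ys) K" "inj_on (\<lambda>k. ys ! (Suc k mod d)) K"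
        using that \<open>inj_on (nth ys) {..<d}\<close> by (auto simp: o_def intro: inj_on_subset)
    qed
    have reindex: "(\<Prod>e\<in>cycle_edge ys ` K. x (fst e) * x (snd e)) =
        (\<Prod>k\<in>K. x (ys ! k) * x (ys ! (Suc k mod d)))" if "K \<subseteq> {..<d}" for K and x :: "nat \<Rightarrow> real"
      using inj_on_subset[OF inj_on_cycle_edge[of ys], of K] that ys d
      by (subst prod.reindex) (auto simp: cycle_edge_def sorted_edge_mult simp del: prod.distrib intro!: prod.cong)
    show "integrable (iid_law N \<nu>) (\<lambda>x. \<Prod>e\<in>T. x (fst e) * x (snd e))" if "T \<subseteq> cycle_edges ys" for T
    proof -
      obtain K where K: "K \<subseteq> {..<d}" "T = cycle_edge ys ` K"
        using \<open>T \<subseteq> cycle_edges ys\<close> ys unfolding cycle_edges_def by (auto simp: subset_image_iff)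
      show ?thesis
        unfolding K(2) reindex[OF K(1)] using inj[OF K(1)] K(1) nth[OF ys(1)] Suc_mod
        by (intro integrable_iid_prod_mult[OF nu b]) auto
    qed
    have images: "(\<lambda>k. ys ! (Suc k mod d)) ` {..<d} = nth ys ` {..<d}"
    proof (rule card_subset_eq)
      show "(\<lambda>k. ys ! (Suc k mod d)) ` {..<d} \<subseteq> nth ys ` {..<d}" using Suc_mod by auto
      show "card ((\<lambda>k. ys ! (Suc k mod d)) ` {..<d}) = card (nth ys ` {..<d})"
        using inj[OF order_refl] by (simp add: card_image)
    qed simp
    show "(\<integral>x. (\<Prod>e\<in>cycle_edges ys. x (fst e) * x (snd e)) \<partial>iid_law N \<nu>) = 1"
      unfolding cycle_edges_def ys(3) reindex[OF order_refl]
      using inj[OF order_refl] images nth[OF ys(1)]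
      by (intro integral_iid_prod_mult[OF nu b]) auto
  qed
  then show ?thesis unfolding total by simp
qed

subsection \<open>Ordered eigenbases\<close>

lemma (in vec_space) card_le_rank:
  assumes A: "A \<in> carrier_mat n nc" and U: "U \<subseteq> col_space A" "lin_indpt U"
  shows "card U \<le> vec_space.rank n A"
proof -
  let ?W = "span (set (cols A))"
  have cols: "set (cols A) \<subseteq> carrier_vec n" using A cols_dim by blast
  have sub: "submodule class_ring ?W V" using cols by (simp add: span_is_submodule)
  have vs: "vectorspace class_ring (vs ?W)"
    using cols by (intro subspace_is_vs span_is_subspace) auto
  have UW: "U \<subseteq> ?W" using U by (simp add: col_space_def)
  have "LinearCombinations.module.lin_indpt class_ring (vs ?W) U"
    using span_li_not_depend(2)[OF UW sub] U(2) by simp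
  then show ?thesis
    unfolding rank_def
    using vectorspace.li_le_dim(2)[OF vs fin_dim_span_cols[OF A], of U] UW by simp
qed

text \<open>Pairing a vanishing combination with \<open>y\<close> leaves only the coefficient
  \<open>a y\<close>.\<close>

lemma orthonormal_lin_indpt:
  fixes U :: "real Matrix.vec set"
  assumes U: "finite U" and dims: "U \<subseteq> carrier_vec n"
    and orth: "\<And>x y. x \<in> U \<Longrightarrow> y \<in> U \<Longrightarrow> scalar_prod x y = (if x = y then 1 else 0)"
  shows "module.lin_indpt class_ring (module_vec TYPE(real) n) U"
proof -
  interpret vec_space "TYPE(real)" n .
  show ?thesis
  proof (rule finite_lin_indpt2[OF U])
    show "U \<subseteq> carrier_vec n" by (rule dims)
    fix a assume lc: "lincomb a U = 0\<^sub>v n"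
    show "\<forall>x\<in>U. a x = 0"
    proof
      fix y assume y: "y \<in> U"
      have "(\<Sum>x\<in>U. a x * vec_index x i) = 0" if "i < n" for i
        using lincomb_index[OF that dims, of a] lc that by simp
      then have "0 = (\<Sum>i<n. vec_index y i * (\<Sum>x\<in>U. a x * vec_index x i))" by simp
      also have "\<dots> = (\<Sum>x\<in>U. a x * (\<Sum>i<n. vec_index y i * vec_index x i))"
        unfolding sum_distrib_left by (subst sum.swap) (simp add: mult_ac)
      also have "\<dots> = (\<Sum>x\<in>U. a x * scalar_prod y x)"
        using dims by (intro sum.cong) (auto simp: scalar_prod_def atLeast0LessThan)
      also have "\<dots> = (\<Sum>x\<in>U. if x = y then a x else 0)"
        using orth y by (intro sum.cong) auto
      also have "\<dots> = a y" using U y by simp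
      finally show "a y = 0" by simp
    qed
  qed
qed

context
  fixes N :: nat and A :: "real Matrix.mat" and v :: "nat \<Rightarrow> real Matrix.vec"
  assumes A: "A \<in> carrier_mat N N" and basis: "ordered_eigenbasis N A v"
begin

lemma basis_carrier: "k \<in> {1..N} \<Longrightarrow> v k \<in> carrier_vec N"
  and basis_eigenvector: "k \<in> {1..N} \<Longrightarrow> eigenvector A (v k) (eigval A k)"
  and basis_scalar_prod: "k \<in> {1..N} \<Longrightarrow> k' \<in> {1..N} \<Longrightarrow>
    scalar_prod (v k) (v k') = (if k = k' then 1 else 0)"
  using basis by (auto simp: ordered_eigenbasis_def)

lemma basis_orthonormal:
  assumes "k \<in> {1..N}" "k' \<in> {1..N}"
  shows "(\<Sum>i<N. vec_index (v k) i * vec_index (v k') i) = (if k = k' then 1 else 0)"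
  using basis_scalar_prod[OF assms] basis_carrier[OF assms(2)]
  by (simp add: scalar_prod_def atLeast0LessThan)

text \<open>The matrix \<open>B\<close> whose rows are the basis vectors satisfies
  \<open>B * transpose_mat B = 1\<^sub>m N\<close>; for square matrices a right inverse is also a
  left inverse.\<close>

lemma basis_complete:
  assumes "i < N" "j < N"
  shows "(\<Sum>k=1..N. vec_index (v k) i * vec_index (v k) j) = (if i = j then 1 else 0)"
proof -
  define B where "B = Matrix.mat N N (\<lambda>(k, i). vec_index (v (Suc k)) i)"
  have B: "B \<in> carrier_mat N N" by (simp add: B_def)
  have "B * transpose_mat B = 1\<^sub>m N"
  proof (rule eq_matI)
    fix i j assume "i < dim_row (1\<^sub>m N :: real Matrix.mat)" "j < dim_col (1\<^sub>m N :: real Matrix.mat)"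
    then have ij: "i < N" "j < N" by auto
    then have "(B * transpose_mat B) $$ (i, j) = (\<Sum>m<N. vec_index (v (Suc i)) m * vec_index (v (Suc j)) m)"
      by (simp add: B_def scalar_prod_def atLeast0LessThan)
    then show "(B * transpose_mat B) $$ (i, j) = 1\<^sub>m N $$ (i, j)"
      using ij basis_orthonormal[of "Suc i" "Suc j"] by simp
  qed (simp_all add: B_def)
  from mat_mult_left_right_inverse[OF B _ this] B
  have "transpose_mat B * B = 1\<^sub>m N" by simp
  then have "(transpose_mat B * B) $$ (i, j) = (if i = j then 1 else 0)"
    using assms by simp
  moreover have "(transpose_mat B * B) $$ (i, j) =
      (\<Sum>k<N. vec_index (v (Suc k)) i * vec_index (v (Suc k)) j)"
    using assms by (auto simp: B_def scalar_prod_def atLeast0LessThan)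
  ultimately show ?thesis
    by (simp add: sum.atLeast1_atMost_eq)
qed

lemma spectral_decomposition_eigval:
  "spectral_decomposition N (\<lambda>i j. A $$ (i, j)) (eigval A) (\<lambda>k. vec_index (v k))"
proof
  show "(\<Sum>i<N. vec_index (v k) i * vec_index (v k') i) = (if k = k' then 1 else 0)"
    if "k \<in> {1..N}" "k' \<in> {1..N}" for k k'
    using that by (rule basis_orthonormal)
  show "A $$ (i, j) = (\<Sum>k=1..N. eigval A k * (vec_index (v k) i * vec_index (v k) j))"
    if ij: "i < N" "j < N" for i j
  proof -
    have eig: "(\<Sum>m<N. A $$ (i, m) * vec_index (v k) m) = eigval A k * vec_index (v k) i"
      if k: "k \<in> {1..N}" for k
    proof -
      have "vec_index (A *\<^sub>v v k) i = vec_index (eigval A k \<cdot>\<^sub>v v k) i"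
        using basis_eigenvector[OF k] by (simp add: eigenvector_def)
      then show ?thesis
        using ij A basis_carrier[OF k] by (simp add: scalar_prod_def atLeast0LessThan)
    qed
    have "A $$ (i, j) = (\<Sum>m<N. A $$ (i, m) * (if m = j then 1 else 0))"
      using ij by (simp add: if_distrib[where f = "\<lambda>x. _ * x"] cong: if_cong)
    also have "\<dots> = (\<Sum>m<N. A $$ (i, m) * (\<Sum>k=1..N. vec_index (v k) m * vec_index (v k) j))"
      using ij by (intro sum.cong refl) (subst basis_complete, auto)
    also have "\<dots> = (\<Sum>k=1..N. (\<Sum>m<N. A $$ (i, m) * vec_index (v k) m) * vec_index (v k) j)"
      unfolding sum_distrib_left sum_distrib_right by (subst sum.swap) (simp add: mult_ac)
    also have "\<dots> = (\<Sum>k=1..N. eigval A k * (vec_index (v k) i * vec_index (v k) j))"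
      by (intro sum.cong refl) (simp only: eig mult.assoc)
    finally show ?thesis .
  qed
qed

text \<open>The number \<open>eigval A 1\<close> is the last entry of the increasing list of roots.
  That \<open>eigval A k\<close> is in this list follows from \<open>v k\<close> being an
  eigenvector, with no count of the roots.\<close>

lemma eigval_le_eigval_1:
  assumes k: "k \<in> {1..N}"
  shows "eigval A k \<le> eigval A 1"
proof -
  let ?L = "sorted_list_of_multiset (proots (char_poly A))"
  have "char_poly A \<noteq> 0" using degree_monic_char_poly[OF A] by auto
  moreover have "poly (char_poly A) (eigval A k) = 0"
    using basis_eigenvector[OF k] eigenvalue_root_char_poly[OF A] by (auto simp: eigenvalue_def)
  ultimately have mem: "eigval A k \<in> set ?L" by simp
  then have "?L \<noteq> []" by (metis empty_iff list.set(1))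
  then have "eigval A 1 = last ?L" by (simp add: eigval_def rev_nth last_conv_nth)
  moreover have "x \<le> last ?L" if "x \<in> set ?L" for x
  proof -
    from that obtain m where "m < length ?L" "x = ?L ! m" unfolding in_set_conv_nth by blast
    then show ?thesis using \<open>?L \<noteq> []\<close> by (auto simp: last_conv_nth intro!: sorted_nth_mono)
  qed
  ultimately show ?thesis using mem by metis
qed

text \<open>An eigenvector with nonzero eigenvalue is the image under \<open>A\<close> of a multiple
  of itself, hence lies in the column space, and these vectors are orthonormal.\<close>

lemma card_nonzero_eigval_le_rank: "card {k \<in> {1..N}. eigval A k \<noteq> 0} \<le> vec_space.rank N A"
proof -
  interpret vec_space "TYPE(real)" N .
  let ?K = "{k \<in> {1..N}. eigval A k \<noteq> 0}"
  have inj: "inj_on v ?K"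
  proof (rule inj_onI)
    fix k k' assume "k \<in> ?K" "k' \<in> ?K" "v k = v k'"
    then show "k = k'" using basis_scalar_prod[of k k] basis_scalar_prod[of k k'] by (auto split: if_splits)
  qed
  have "card (v ` ?K) \<le> vec_space.rank N A"
  proof (rule card_le_rank[OF A])
    show "v ` ?K \<subseteq> col_space A"
    proof
      fix x assume "x \<in> v ` ?K"
      then obtain k where k: "k \<in> {1..N}" "eigval A k \<noteq> 0" "x = v k" by auto
      have "A *\<^sub>v ((1 / eigval A k) \<cdot>\<^sub>v v k) = (1 / eigval A k) \<cdot>\<^sub>v (A *\<^sub>v v k)"
        using A basis_carrier[OF k(1)] by (rule mult_mat_vec)
      also have "\<dots> = v k"
        using basis_eigenvector[OF k(1)] k(2) by (auto simp: eigenvector_def smult_smult_assoc)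
      finally show "x \<in> col_space A"
        unfolding col_space_eq[OF A] using A basis_carrier[OF k(1)] k(3)
        by (auto intro!: bexI[of _ "(1 / eigval A k) \<cdot>\<^sub>v v k"])
    qed
    show "lin_indpt (v ` ?K)"
    proof (rule orthonormal_lin_indpt)
      show "scalar_prod x y = (if x = y then 1 else 0)" if "x \<in> v ` ?K" "y \<in> v ` ?K" for x y
        using that inj_onD[OF inj] by (auto simp: basis_scalar_prod)
    qed (use basis_carrier in auto)
  qed
  then show ?thesis using card_image[OF inj] by simp
qed

lemma trace_eq_sum_eigval: "(\<Sum>i<N. A $$ (i, i)) = (\<Sum>k=1..N. eigval A k)"
proof -
  interpret spectral_decomposition N "\<lambda>i j. A $$ (i, j)" "eigval A" "\<lambda>k. vec_index (v k)"
    by (rule spectral_decomposition_eigval)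
  show ?thesis
    using trace_spectral_power[of "Suc 0"] by (simp add: spectral_power_1)
qed

lemma psd_eigval_nonneg:
  assumes "psd N A" and k: "k \<in> {1..N}"
  shows "0 \<le> eigval A k"
proof -
  have "0 \<le> scalar_prod (v k) (A *\<^sub>v v k)" using assms basis_carrier[OF k] by (auto simp: psd_def)
  also have "\<dots> = eigval A k"
    using basis_eigenvector[OF k] basis_carrier[OF k] basis_scalar_prod[OF k k]
    by (simp add: eigenvector_def)
  finally show ?thesis .
qed

text \<open>The trace is nonnegative, so the negative eigenvalues are outweighed by the positive ones,
  of which there are at most \<open>rank A\<close>, each at most \<open>eigval A 1\<close>.\<close>
lemma sum_abs_eigval_le_rank:
  assumes trace: "0 \<le> (\<Sum>i<N. A $$ (i, i))" and pos: "0 \<le> eigval A 1"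
  shows "(\<Sum>k=1..N. \<bar>eigval A k\<bar>) \<le> 2 * real (vec_space.rank N A) * eigval A 1"
proof -
  let ?K = "{k \<in> {1..N}. eigval A k \<noteq> 0}"
  have "(\<Sum>k=1..N. \<bar>eigval A k\<bar>) \<le> (\<Sum>k=1..N. \<bar>eigval A k\<bar>) + (\<Sum>k=1..N. eigval A k)"
    using trace by (simp add: trace_eq_sum_eigval)
  also have "\<dots> = (\<Sum>k=1..N. \<bar>eigval A k\<bar> + eigval A k)" by (simp add: sum.distrib)
  also have "\<dots> = (\<Sum>k\<in>?K. \<bar>eigval A k\<bar> + eigval A k)" by (intro sum.mono_neutral_right) auto
  also have "\<dots> \<le> (\<Sum>k\<in>?K. 2 * eigval A 1)"
  proof (rule sum_mono)
    fix k assume "k \<in> ?K"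
    then have "eigval A k \<le> eigval A 1" by (intro eigval_le_eigval_1) simp
    then show "\<bar>eigval A k\<bar> + eigval A k \<le> 2 * eigval A 1" using pos by simp
  qed
  also have "\<dots> = real (card ?K) * (2 * eigval A 1)" by simp
  also have "\<dots> \<le> real (vec_space.rank N A) * (2 * eigval A 1)"
    using card_nonzero_eigval_le_rank pos by (intro mult_right_mono) auto
  finally show ?thesis by (simp add: mult_ac)
qed

end

subsection \<open>Divergence\<close>

lemma abs_vec_index_le_sup_norm: "x < dim_vec w \<Longrightarrow> \<bar>vec_index w x\<bar> \<le> sup_norm w"
  unfolding sup_norm_def by (rule Max_ge) auto

text \<open>The powers of \<open>1 / N\<close> are absorbed into the eigenvalues, so that the
  normalised quantities of the limit argument appear. The largest entry of the eigenvectors plays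
  the role of \<open>\<delta>\<close> in the walk bound.\<close>

lemma low_degree_chi2_ge_spectral:
  assumes profile: "variance_profile N \<Delta>" and N: "N \<ge> 1"
    and nu: "prob_space \<nu>" "sets \<nu> = sets borel" and b: "(\<integral>x. x\<^sup>2 \<partial>\<nu>) = 1"
    and beta: "\<beta> > 0" and d: "even d" "d \<ge> 3" "d \<le> D"
    and basis: "ordered_eigenbasis N (recip_profile \<Delta>) v"
  shows "ereal (\<beta> ^ (2 * d) *
      ((eigval (recip_profile \<Delta>) 1 / real N) ^ d -
        (real d)\<^sup>2 * (Max ((\<lambda>i. sup_norm (v i)) ` {1..N}))\<^sup>2 *
        ((\<Sum>k=1..N. \<bar>eigval (recip_profile \<Delta>) k\<bar>) / real N) ^ d) / (real d)\<^sup>2 - 1)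
    \<le> low_degree_chi2 (observed \<Delta>) D
        (planted_law \<Delta> (spike_signal N \<beta> (iid_law N \<nu>))) (null_law \<Delta>)"
proof -
  let ?A = "recip_profile \<Delta>" and ?\<delta> = "Max ((\<lambda>i. sup_norm (v i)) ` {1..N})"
  let ?t = "\<Sum>k=1..N. \<bar>eigval ?A k\<bar>"
  let ?S = "\<Sum>ys | ys \<in> words N d \<and> distinct ys. walk_weight (\<lambda>i j. ?A $$ (i, j)) (ys @ [hd ys])"
  have A: "?A \<in> carrier_mat N N"
    using profile by (auto simp: variance_profile_def symmetric_matrix_def recip_profile_def)
  interpret spectral_decomposition N "\<lambda>i j. ?A $$ (i, j)" "eigval ?A" "\<lambda>k. vec_index (v k)"
    by (rule spectral_decomposition_eigval[OF A basis])
  have deloc: "\<bar>vec_index (v k) x\<bar> \<le> ?\<delta>" if "k \<in> {1..N}" "x < N" for k x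
  proof -
    have "\<bar>vec_index (v k) x\<bar> \<le> sup_norm (v k)"
      using that basis_carrier[OF A basis that(1)] by (intro abs_vec_index_le_sup_norm) auto
    also have "\<dots> \<le> ?\<delta>" using that(1) by (intro Max_ge) auto
    finally show ?thesis .
  qed
  have "eigval ?A 1 ^ d - (real d)\<^sup>2 * ?\<delta>\<^sup>2 * ?t ^ d \<le> ?S"
    using N d by (intro sum_distinct_closed_walks_ge recip_profile_nonneg[OF profile] deloc) auto
  then have "(\<beta>\<^sup>2 / real N) ^ d * (eigval ?A 1 ^ d - (real d)\<^sup>2 * ?\<delta>\<^sup>2 * ?t ^ d) / (real d)\<^sup>2 - 1
      \<le> (\<beta>\<^sup>2 / real N) ^ d * ?S / (real d)\<^sup>2 - 1"
    by (intro diff_right_mono divide_right_mono mult_left_mono) auto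
  moreover have "(\<beta>\<^sup>2 / real N) ^ d * (eigval ?A 1 ^ d - (real d)\<^sup>2 * ?\<delta>\<^sup>2 * ?t ^ d) =
      \<beta> ^ (2 * d) * ((eigval ?A 1 / real N) ^ d - (real d)\<^sup>2 * ?\<delta>\<^sup>2 * (?t / real N) ^ d)"
    by (simp add: power_divide power_mult diff_divide_distrib right_diff_distrib)
  ultimately show ?thesis
    using low_degree_chi2_ge_cycles[OF profile N nu b beta d(2,3)]
    by (simp only:) (meson ereal_less_eq(3) order_trans)
qed

text \<open>Exponential growth beats the quadratic denominator. The 2 makes up for the half of
  \<open>\<mu> ^ d\<close> that the error term may consume in the theorem.\<close>

lemma exists_even_degree:
  fixes q B :: real
  assumes "q > 1"
  obtains d where "even d" "d \<ge> 3" "q ^ d / (2 * (real d)\<^sup>2) > B"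
proof -
  have lim: "filterlim (\<lambda>n. q ^ (2 * n) / (2 * (real (2 * n))\<^sup>2)) at_top sequentially"
    using assms by real_asymp
  have "eventually (\<lambda>n. n \<ge> 2 \<and> B < q ^ (2 * n) / (2 * (real (2 * n))\<^sup>2)) sequentially"
    by (rule eventually_conj[OF eventually_ge_at_top filterlim_at_top_dense[THEN iffD1, OF lim, rule_format]])
  then obtain n where "n \<ge> 2 \<and> B < q ^ (2 * n) / (2 * (real (2 * n))\<^sup>2)"
    using eventually_happens' sequentially_bot by blast
  then show ?thesis by (intro that[of "2 * n"]) auto
qed

theorem theorem1p13:
  fixes \<Delta> :: "nat \<Rightarrow> ereal Matrix.mat"
    and \<Phi> :: "nat \<Rightarrow> real Matrix.mat"
    and \<mu>\<^sub>1 \<beta>s \<beta> :: real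
    and \<nu> :: "real measure"
    and v :: "nat \<Rightarrow> nat \<Rightarrow> real Matrix.vec"
    and D :: "nat \<Rightarrow> nat"
  assumes profile: "\<And>N. N \<ge> 1 \<Longrightarrow> variance_profile N (\<Delta> N)"
    and recip: "\<And>N. N \<ge> 1 \<Longrightarrow> \<Phi> N = recip_profile (\<Delta> N)"
    and mu1: "(\<lambda>N. eigval (\<Phi> N) 1 / real N) \<longlonglongrightarrow> \<mu>\<^sub>1" "\<mu>\<^sub>1 > 0"
    and beta_star: "\<beta>s = 1 / sqrt \<mu>\<^sub>1"
    and nu: "prob_space \<nu>" "sets \<nu> = sets borel"
    and beta: "\<beta> > 0"
    and a: "(\<integral>x. x \<partial>\<nu>) = 0"
    and b: "(\<integral>x. x\<^sup>2 \<partial>\<nu>) = 1"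
    and c: "bounded (measure_support \<nu>)"
    and basis: "\<And>N. N \<ge> 1 \<Longrightarrow> ordered_eigenbasis N (\<Phi> N) (v N)"
    and d: "(\<lambda>N. Max ((\<lambda>i. sup_norm (v N i)) ` {1..N})) \<longlonglongrightarrow> 0"
    and e: "(\<forall>N\<ge>1. psd N (\<Phi> N)) \<or>
            (\<exists>K. (\<forall>N\<ge>1. vec_space.rank N (\<Phi> N) \<le> K) \<and>
                 (\<forall>i\<in>{1..K}. convergent (\<lambda>N. eigval (\<Phi> N) i / real N)))"
    and above: "\<beta> > \<beta>s"
    and deg: "filterlim D at_top sequentially"
  shows "(\<lambda>N. low_degree_chi2 (observed (\<Delta> N)) (D N)
            (planted_law (\<Delta> N) (spike_signal N \<beta> (iid_law N \<nu>)))
            (null_law (\<Delta> N))) \<longlonglongrightarrow> \<infinity>"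
proof -
  let ?chi = "\<lambda>N. low_degree_chi2 (observed (\<Delta> N)) (D N)
            (planted_law (\<Delta> N) (spike_signal N \<beta> (iid_law N \<nu>))) (null_law (\<Delta> N))"
  define t where "t N = (\<Sum>k=1..N. \<bar>eigval (\<Phi> N) k\<bar>) / real N" for N
  define \<delta> where "\<delta> N = Max ((\<lambda>i. sup_norm (v N i)) ` {1..N})" for N
  note d_lim = d
  have basis': "ordered_eigenbasis N (recip_profile (\<Delta> N)) (v N)" if "N \<ge> 1" for N
    using basis[OF that] recip[OF that] by simp
  have carrier: "\<Phi> N \<in> carrier_mat N N" if "N \<ge> 1" for N
    using profile[OF that] recip[OF that]
    by (auto simp: variance_profile_def symmetric_matrix_def recip_profile_def)
  have ev_N: "eventually (\<lambda>N. N \<ge> 1) sequentially" by (rule eventually_ge_at_top)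
  have ev_D: "eventually (\<lambda>N. D N \<ge> m) sequentially" for m
    using deg by (simp add: filterlim_at_top)
  \<comment> \<open>For each large \<open>N\<close> separately: either the normalised sum of
    absolute eigenvalues is bounded, so that the cycle test is effective, or the divergence already
    exceeds \<open>r\<close>. The bound \<open>R\<close> may depend on \<open>r\<close>.\<close>
  have bounded_or_large: "\<exists>R\<ge>0. eventually (\<lambda>N. t N \<le> R \<or> ereal r < ?chi N) sequentially" for r
    using e
  proof
    assume psd: "\<forall>N\<ge>1. psd N (\<Phi> N)"
    \<comment> \<open>Above this threshold the trace test exceeds \<open>r\<close>; the absolute
      value keeps the threshold nonnegative.\<close>
    have "eventually (\<lambda>N. t N \<le> (\<bar>r\<bar> + 1) / \<beta>\<^sup>2 \<or> ereal r < ?chi N) sequentially"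
      using ev_N ev_D[of 1]
    proof eventually_elim
      case (elim N)
      have "t N = (\<Sum>i<N. \<Phi> N $$ (i, i)) / real N"
        unfolding t_def trace_eq_sum_eigval[OF carrier basis, OF elim(1) elim(1)]
        using psd_eigval_nonneg[OF carrier basis, OF elim(1) elim(1)] psd elim(1) by simp
      then have "ereal (\<beta>\<^sup>2 * t N - 1) \<le> ?chi N"
        using low_degree_chi2_ge_trace[OF profile[OF elim(1)] elim(1) nu b beta elim(2)]
        by (simp add: recip[OF elim(1)])
      moreover have "r < \<beta>\<^sup>2 * t N - 1" if "\<not> t N \<le> (\<bar>r\<bar> + 1) / \<beta>\<^sup>2"
        using that beta by (simp add: field_simps)
      ultimately show ?case by (meson less_ereal.simps(1) less_le_trans)
    qed
    then show ?thesis by (intro exI[of _ "(\<bar>r\<bar> + 1) / \<beta>\<^sup>2"]) auto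
  next
    assume "\<exists>K. (\<forall>N\<ge>1. vec_space.rank N (\<Phi> N) \<le> K) \<and>
                 (\<forall>i\<in>{1..K}. convergent (\<lambda>N. eigval (\<Phi> N) i / real N))"
    then obtain K where K: "\<And>N. N \<ge> 1 \<Longrightarrow> vec_space.rank N (\<Phi> N) \<le> K" by blast
    have "eventually (\<lambda>N. 0 < eigval (\<Phi> N) 1 / real N) sequentially"
      "eventually (\<lambda>N. eigval (\<Phi> N) 1 / real N < \<mu>\<^sub>1 + 1) sequentially"
      using order_tendstoD[OF mu1(1)] mu1(2) by auto
    \<comment> \<open>In bounded rank the sum is at most \<open>2 * K\<close> times
      \<open>eigval (\<Phi> N) 1\<close>, and the latter is eventually below
      \<open>(\<mu>\<^sub>1 + 1) * N\<close>.\<close>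
    with ev_N have "eventually (\<lambda>N. t N \<le> 2 * real K * (\<mu>\<^sub>1 + 1)) sequentially"
    proof eventually_elim
      case (elim N)
      then have pos: "0 \<le> eigval (\<Phi> N) 1" by (simp add: zero_less_divide_iff)
      have "0 \<le> (\<Sum>i<N. \<Phi> N $$ (i, i))"
        using recip_profile_nonneg[OF profile[OF elim(1)]] recip[OF elim(1)] by (intro sum_nonneg) auto
      from sum_abs_eigval_le_rank[OF carrier basis, OF elim(1) elim(1) this pos]
      have "t N \<le> 2 * real (vec_space.rank N (\<Phi> N)) * eigval (\<Phi> N) 1 / real N"
        unfolding t_def by (rule divide_right_mono) simp
      also have "\<dots> = 2 * real (vec_space.rank N (\<Phi> N)) * (eigval (\<Phi> N) 1 / real N)" by simp
      also have "\<dots> \<le> 2 * real K * (\<mu>\<^sub>1 + 1)"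
        using K[OF elim(1)] elim(2,3) by (intro mult_mono) auto
      finally show ?case .
    qed
    then show ?thesis
      using mu1(2) by (intro exI[of _ "2 * real K * (\<mu>\<^sub>1 + 1)"]) (auto elim: eventually_mono)
  qed
  show ?thesis
    unfolding tendsto_PInfty
  proof
    fix r :: real
    obtain R where R: "R \<ge> 0" "eventually (\<lambda>N. t N \<le> R \<or> ereal r < ?chi N) sequentially"
      using bounded_or_large by blast
    have "1 / \<beta>\<^sup>2 < \<mu>\<^sub>1"
    proof -
      have "1 / \<beta> < sqrt \<mu>\<^sub>1" using above beta mu1(2) unfolding beta_star by (simp add: field_simps)
      then have "(1 / \<beta>)\<^sup>2 < (sqrt \<mu>\<^sub>1)\<^sup>2" using beta by (intro power_strict_mono) auto
      then show ?thesis using mu1(2) by (simp add: power_divide)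
    qed
    \<comment> \<open>A value strictly between leaves room on both sides: eventually
      \<open>eigval (\<Phi> N) 1 / N\<close> exceeds \<open>\<mu>\<close>, and
      \<open>\<beta>\<^sup>2 * \<mu>\<close> is still above 1.\<close>
    then obtain \<mu> where \<mu>: "1 / \<beta>\<^sup>2 < \<mu>" "\<mu> < \<mu>\<^sub>1" using dense by blast
    have \<mu>_pos: "\<mu> > 0" using \<mu>(1) beta by (smt (verit) zero_less_divide_1_iff zero_less_power)
    have "\<beta>\<^sup>2 * \<mu> > 1" using \<mu>(1) beta by (simp add: field_simps)
    \<comment> \<open>The degree \<open>d\<close> depends on \<open>r\<close> but not on
      \<open>N\<close>, so \<open>D N\<close> eventually reaches it.\<close>
    then obtain d where d: "even d" "d \<ge> 3" "(\<beta>\<^sup>2 * \<mu>) ^ d / (2 * (real d)\<^sup>2) > r + 1"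
      by (rule exists_even_degree)
    \<comment> \<open>With \<open>d\<close> and \<open>R\<close> fixed, delocalisation sends the
      error from repeated vertices to 0, so it eventually costs less than half of
      \<open>\<mu> ^ d\<close>.\<close>
    have "(\<lambda>N. (real d)\<^sup>2 * (\<delta> N)\<^sup>2 * R ^ d) \<longlonglongrightarrow> (real d)\<^sup>2 * 0\<^sup>2 * R ^ d"
      using d_lim unfolding \<delta>_def[symmetric] by (intro tendsto_intros)
    then have "eventually (\<lambda>N. (real d)\<^sup>2 * (\<delta> N)\<^sup>2 * R ^ d < \<mu> ^ d / 2) sequentially"
      using \<mu>_pos by (intro order_tendstoD) auto
    moreover have "eventually (\<lambda>N. \<mu> < eigval (\<Phi> N) 1 / real N) sequentially"
      using order_tendstoD(1)[OF mu1(1) \<mu>(2)] .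
    ultimately show "eventually (\<lambda>N. ereal r < ?chi N) sequentially"
      using R(2) ev_N ev_D[of d]
    proof eventually_elim
      case (elim N)
      show ?case
      proof (cases "t N \<le> R")
        case False
        then show ?thesis using elim(3) by simp
      next
        case True
        have "0 \<le> t N" unfolding t_def by (intro divide_nonneg_nonneg sum_nonneg) auto
        then have "(real d)\<^sup>2 * (\<delta> N)\<^sup>2 * t N ^ d \<le> (real d)\<^sup>2 * (\<delta> N)\<^sup>2 * R ^ d"
          using True by (intro mult_left_mono power_mono) auto
        moreover have "\<mu> ^ d \<le> (eigval (\<Phi> N) 1 / real N) ^ d"
          using elim(2) \<mu>_pos by (intro power_mono) auto
        ultimately have "\<mu> ^ d / 2 \<le> (eigval (\<Phi> N) 1 / real N) ^ d - (real d)\<^sup>2 * (\<delta> N)\<^sup>2 * t N ^ d"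
          using elim(1) by linarith
        then have "\<beta> ^ (2 * d) * (\<mu> ^ d / 2) / (real d)\<^sup>2 - 1 \<le> \<beta> ^ (2 * d) *
            ((eigval (\<Phi> N) 1 / real N) ^ d - (real d)\<^sup>2 * (\<delta> N)\<^sup>2 * t N ^ d) / (real d)\<^sup>2 - 1"
          using beta by (intro diff_right_mono divide_right_mono mult_left_mono) auto
        moreover have "\<beta> ^ (2 * d) * (\<mu> ^ d / 2) / (real d)\<^sup>2 = (\<beta>\<^sup>2 * \<mu>) ^ d / (2 * (real d)\<^sup>2)"
          by (simp add: power_mult_distrib power_mult)
        ultimately have "r < \<beta> ^ (2 * d) *
            ((eigval (\<Phi> N) 1 / real N) ^ d - (real d)\<^sup>2 * (\<delta> N)\<^sup>2 * t N ^ d) / (real d)\<^sup>2 - 1"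
          using d(3) by linarith
        moreover have "ereal (\<beta> ^ (2 * d) *
            ((eigval (\<Phi> N) 1 / real N) ^ d - (real d)\<^sup>2 * (\<delta> N)\<^sup>2 * t N ^ d) / (real d)\<^sup>2 - 1) \<le> ?chi N"
          using low_degree_chi2_ge_spectral[OF profile[OF elim(4)] elim(4) nu b beta d(1,2) elim(5) basis'[OF elim(4)]]
          by (simp only: t_def \<delta>_def recip[OF elim(4)])
        ultimately show ?thesis by (meson less_ereal.simps(1) less_le_trans)
      qed
    qed
  qed
qed

end
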